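(* There exists a map $Z\mapsto\mu_Z$ from $2^{\omega}$ to the continuous (atomless) Borel probability measures on $2^{\omega}$ such that for every class $\mathcal{C}$ of computable reals: $\mathcal{C}$ is EX-learnable if and only if $\{\mu_Z: Z\in\mathcal{C}\}$ is a weakly EX-learnable class of computable measures; and $\mathcal{C}$ is BC-learnable if and only if $\{\mu_Z: Z\in\mathcal{C}\}$ is a weakly BC-learnable class of computable measures.
   Context: Reals are elements of $2^{\omega}$; $2^{<\omega}$ is the set of binary strings, $[\sigma]$ the set of reals extending $\sigma$, $X\upharpoonright n$ the first $n$ bits of $X$. A measure is identified with $\sigma\mapsto\mu([\sigma])$ and is computable if this function is computable. Fix a uniform enumeration $(\mu_e)$ of partial computable measures ($e$ is an index of computable $\mu$ if $\mu_e$ is total and equals $\mu$) and an acceptable numbering $(\varphi_e)$ of partial computable $\{0,1\}$-valued functions ($e$ is an index of computable real $Z$ if $\varphi_e=Z$). For computable $\mu$, $X$ is $\mu$-random if it is Martin-Löf random with respect to $\mu$. A learner is a function $\mathcal{L}:2^{<\omega}\to\mathbb{N}$. A class $\mathcal{C}$ of computable reals is EX-learnable if some computable learner $\mathcal{L}$ satisfies: for every $Z\in\mathcal{C}$, $\lim_n\mathcal{L}(Z\upharpoonright n)$ exists and is an index of $Z$; BC-learnable if some computable learner satisfies: for every $Z\in\mathcal{C}$, $\mathcal{L}(Z\upharpoonright n)$ is an index of $Z$ for all sufficiently large $n$. A class $\mathcal{C}$ of computable measures is weakly EX-learnable if some computable learner $\mathcal{L}$ satisfies: for every $\mu\in\mathcal{C}$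 and every $\mu$-random $X$, $\lim_n\mathcal{L}(X\upharpoonright n)$ exists and is an index of a computable measure $\mu'$ (not necessarily in $\mathcal{C}$) such that $X$ is $\mu'$-random; weakly BC-learnable if some computable learner satisfies: for every $\mu\in\mathcal{C}$ and every $\mu$-random $X$ there exist $n_0$ and a computable measure $\mu'$ with $X$ $\mu'$-random such that $\mathcal{L}(X\upharpoonright n)$ is an index of $\mu'$ for all $n>n_0$. *)

theory Defs
  imports "HOL-Probability.Probability" "HOL-Library.Nat_Bijection"
begin

text \<open>Kleene's schemes. Programs carry no arity: a program is run on an argument list, and its
  restriction to lists of length \<open>k\<close> is a \<open>k\<close>-ary partial recursive function. The recursion
  argument of \<open>PrimRec\<close> and the search argument of \<open>Mu\<close> come first.\<close>

datatype recf =
    Zero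
  | Succ
  | Proj nat
  | Comp recf "recf list"
  | PrimRec recf recf
  | Mu recf

primrec recf_eval :: "recf \<Rightarrow> nat list \<Rightarrow> nat option" where
  "recf_eval Zero = (\<lambda>xs. Some 0)"
| "recf_eval Succ = (\<lambda>xs. case xs of [] \<Rightarrow> None | x # _ \<Rightarrow> Some (Suc x))"
| "recf_eval (Proj i) = (\<lambda>xs. if i < length xs then Some (xs ! i) else None)"
| "recf_eval (Comp f gs) = (\<lambda>xs.
     let ys = map (\<lambda>g. g xs) (map recf_eval gs)
     in if None \<in> set ys then None else recf_eval f (map the ys))"
| "recf_eval (PrimRec f g) = (\<lambda>xs. case xs of [] \<Rightarrow> None
     | n # xs' \<Rightarrow> rec_nat (recf_eval f xs')
         (\<lambda>k r. Option.bind r (\<lambda>v. recf_eval g (k # v # xs'))) n)"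
| "recf_eval (Mu f) = (\<lambda>xs.
     let P = (\<lambda>n. recf_eval f (n # xs) = Some 0 \<and>
                  (\<forall>m<n. \<exists>v. recf_eval f (m # xs) = Some (Suc v)))
     in if \<exists>n. P n then Some (THE n. P n) else None)"

definition computable_fun :: "(nat \<Rightarrow> nat) \<Rightarrow> bool" where
  "computable_fun f \<longleftrightarrow> (\<exists>r. \<forall>n. recf_eval r [n] = Some (f n))"

type_synonym cantor = "nat \<Rightarrow> bool"

definition prefix_of :: "cantor \<Rightarrow> nat \<Rightarrow> bool list" where
  "prefix_of X n = map X [0..<n]"

definition cylinder :: "bool list \<Rightarrow> cantor set" where
  "cylinder \<sigma> = {X. prefix_of X (length \<sigma>) = \<sigma>}"

definition str_code :: "bool list \<Rightarrow> nat" where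
  "str_code \<sigma> = list_encode (map of_bool \<sigma>)"

definition computable_real :: "cantor \<Rightarrow> bool" where
  "computable_real Z \<longleftrightarrow> (\<exists>r. \<forall>n. recf_eval r [n] = Some (of_bool (Z n)))"

definition computable_learner :: "(bool list \<Rightarrow> nat) \<Rightarrow> bool" where
  "computable_learner L \<longleftrightarrow> (\<exists>r. \<forall>\<sigma>. recf_eval r [str_code \<sigma>] = Some (L \<sigma>))"

definition uniformly_partial_computable :: "(nat \<Rightarrow> nat \<Rightarrow> bool option) \<Rightarrow> bool" where
  "uniformly_partial_computable \<psi> \<longleftrightarrow>
     (\<exists>r. \<forall>e n. recf_eval r [e, n] = map_option of_bool (\<psi> e n))"

text \<open>Acceptability in the sense of Rogers. Taking \<open>\<psi>\<close> constant in its first argument shows that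
  \<open>\<phi>\<close> enumerates all partial computable 0-1-valued functions.\<close>

definition acceptable_numbering :: "(nat \<Rightarrow> nat \<Rightarrow> bool option) \<Rightarrow> bool" where
  "acceptable_numbering \<phi> \<longleftrightarrow>
     uniformly_partial_computable \<phi> \<and>
     (\<forall>\<psi>. uniformly_partial_computable \<psi> \<longrightarrow>
        (\<exists>f. computable_fun f \<and> (\<forall>e. \<phi> (f e) = \<psi> e)))"

definition real_index :: "(nat \<Rightarrow> nat \<Rightarrow> bool option) \<Rightarrow> nat \<Rightarrow> cantor \<Rightarrow> bool" where
  "real_index \<phi> e Z \<longleftrightarrow> (\<forall>n. \<phi> e n = Some (Z n))"

definition borel_prob :: "cantor measure \<Rightarrow> bool" where
  "borel_prob \<mu> \<longleftrightarrow> prob_space \<mu> \<and> sets \<mu> = sets borel"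

definition continuous_measure :: "cantor measure \<Rightarrow> bool" where
  "continuous_measure \<mu> \<longleftrightarrow> (\<forall>X. measure \<mu> {X} = 0)"

text \<open>Only nonnegative rationals need codes, since only values of measures are approximated.\<close>

definition rat_of_code :: "nat \<Rightarrow> real" where
  "rat_of_code c = (case prod_decode c of (a, b) \<Rightarrow> real a / real (Suc b))"

definition names_real :: "(nat \<Rightarrow> nat option) \<Rightarrow> real \<Rightarrow> bool" where
  "names_real h x \<longleftrightarrow> (\<forall>n. \<exists>c. h n = Some c \<and> \<bar>rat_of_code c - x\<bar> \<le> (1 / 2) ^ n)"

definition computable_measure :: "cantor measure \<Rightarrow> bool" where
  "computable_measure \<mu> \<longleftrightarrow> borel_prob \<mu> \<and>
     (\<exists>r. \<forall>\<sigma>. names_real (\<lambda>n. recf_eval r [str_code \<sigma>, n]) (measure \<mu> (cylinder \<sigma>)))"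

text \<open>A partial real-valued function on strings is partial computable if some program computes
  rational approximations of its values; it is undefined at \<open>\<sigma>\<close> exactly when the approximations
  fail to name a real (a real has at most one value for a given name).\<close>

definition uniformly_partial_computable_real ::
    "(nat \<Rightarrow> bool list \<Rightarrow> real option) \<Rightarrow> bool" where
  "uniformly_partial_computable_real F \<longleftrightarrow>
     (\<exists>r. \<forall>e \<sigma> x. F e \<sigma> = Some x \<longleftrightarrow>
        names_real (\<lambda>n. recf_eval r [e, str_code \<sigma>, n]) x)"

definition partial_measure :: "(bool list \<Rightarrow> real option) \<Rightarrow> bool" where
  "partial_measure m \<longleftrightarrow>
     (\<forall>x. m [] = Some x \<longrightarrow> x = 1) \<and>
     (\<forall>\<sigma> x. m \<sigma> = Some x \<longrightarrow> 0 \<le> x) \<and>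
     (\<forall>\<sigma> x y z. m \<sigma> = Some x \<and> m (\<sigma> @ [False]) = Some y \<and> m (\<sigma> @ [True]) = Some z
        \<longrightarrow> x = y + z)"

definition measure_index ::
    "(nat \<Rightarrow> bool list \<Rightarrow> real option) \<Rightarrow> nat \<Rightarrow> cantor measure \<Rightarrow> bool" where
  "measure_index M e \<mu> \<longleftrightarrow> (\<forall>\<sigma>. M e \<sigma> = Some (measure \<mu> (cylinder \<sigma>)))"

text \<open>A uniform enumeration of the partial computable measures. As for the \<open>\<phi>\<close> above, it is not
  enough that every computable measure occurs: the enumeration must be acceptable, that is, from a
  program for a measure one can compute an index of it. (Learnability is not invariant under
  other changes of numbering.) The requirement is only imposed for total measures, since partial
  ones are never indices of anything.\<close>

definition acceptable_measure_enumeration :: "(nat \<Rightarrow> bool list \<Rightarrow> real option) \<Rightarrow> bool" where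
  "acceptable_measure_enumeration M \<longleftrightarrow>
     (\<forall>e. partial_measure (M e)) \<and>
     uniformly_partial_computable_real M \<and>
     (\<forall>F. uniformly_partial_computable_real F \<longrightarrow>
        (\<exists>f. computable_fun f \<and>
          (\<forall>e \<mu>. borel_prob \<mu> \<and> measure_index F e \<mu> \<longrightarrow> measure_index M (f e) \<mu>)))"

definition ml_test :: "cantor measure \<Rightarrow> (nat \<Rightarrow> cantor set) \<Rightarrow> bool" where
  "ml_test \<mu> U \<longleftrightarrow>
     (\<exists>r. \<forall>n. U n = \<Union> (cylinder ` {\<sigma>. recf_eval r [n, str_code \<sigma>] \<noteq> None})) \<and>
     (\<forall>n. measure \<mu> (U n) \<le> (1 / 2) ^ n)"

definition ml_random :: "cantor measure \<Rightarrow> cantor \<Rightarrow> bool" where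
  "ml_random \<mu> X \<longleftrightarrow> (\<forall>U. ml_test \<mu> U \<longrightarrow> X \<notin> (\<Inter>n. U n))"

definition EX_learnable :: "(nat \<Rightarrow> nat \<Rightarrow> bool option) \<Rightarrow> cantor set \<Rightarrow> bool" where
  "EX_learnable \<phi> C \<longleftrightarrow>
     (\<exists>L. computable_learner L \<and>
       (\<forall>Z\<in>C. \<exists>e. (\<lambda>n. L (prefix_of Z n)) \<longlonglongrightarrow> e \<and> real_index \<phi> e Z))"

definition BC_learnable :: "(nat \<Rightarrow> nat \<Rightarrow> bool option) \<Rightarrow> cantor set \<Rightarrow> bool" where
  "BC_learnable \<phi> C \<longleftrightarrow>
     (\<exists>L. computable_learner L \<and>
       (\<forall>Z\<in>C. \<forall>\<^sub>F n in sequentially. real_index \<phi> (L (prefix_of Z n)) Z))"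

definition weakly_EX_learnable ::
    "(nat \<Rightarrow> bool list \<Rightarrow> real option) \<Rightarrow> cantor measure set \<Rightarrow> bool" where
  "weakly_EX_learnable M D \<longleftrightarrow>
     (\<exists>L. computable_learner L \<and>
       (\<forall>\<mu>\<in>D. \<forall>X. ml_random \<mu> X \<longrightarrow>
         (\<exists>e \<mu>'. (\<lambda>n. L (prefix_of X n)) \<longlonglongrightarrow> e \<and>
            computable_measure \<mu>' \<and> measure_index M e \<mu>' \<and> ml_random \<mu>' X)))"

definition weakly_BC_learnable ::
    "(nat \<Rightarrow> bool list \<Rightarrow> real option) \<Rightarrow> cantor measure set \<Rightarrow> bool" where
  "weakly_BC_learnable M D \<longleftrightarrow>
     (\<exists>L. computable_learner L \<and>
       (\<forall>\<mu>\<in>D. \<forall>X. ml_random \<mu> X \<longrightarrow>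
         (\<exists>n0 \<mu>'. computable_measure \<mu>' \<and> ml_random \<mu>' X \<and>
            (\<forall>n>n0. measure_index M (L (prefix_of X n)) \<mu>'))))"

end

theory Submission
  imports Defs
begin

text \<open>The measure of \<open>Z\<close> is the distribution of \<open>X\<close> with fair independent bits at the even
  positions and \<open>X (2 * i + 1) = Z i\<close>. Its random reals carry \<open>Z\<close> on the odd positions, so a
  learner of \<open>Z\<close> yields a learner of its measure.

  Conversely, if \<open>X\<close> carries \<open>Z\<close> and is random for a computable measure \<open>\<mu>'\<close>, then \<open>Z\<close> is an atom of
  the projection \<open>\<nu>\<close> of \<open>\<mu>'\<close> to the odd positions, as a null fiber over a computable real is
  effectively null. From an index of \<open>\<mu>'\<close> and a prefix of \<open>Z\<close> so long that \<open>Z\<close> has most of its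
  \<open>\<nu>\<close>-measure, \<open>Z\<close> is computable: its longer prefixes are the strings with more than half of that
  measure. The missing even bits are averaged out. In the BC case, for large \<open>n\<close> most of the \<open>2\<^sup>n\<close>
  choices of the first even bits lead to such an index, and the learner outputs a program that
  takes a majority vote. In the EX case, some index is the limit on a set of positive measure. That
  a given index is the limit from a given stage on with at least a given measure, and that a given
  prefix is long enough, can be refuted if it is false, so the learner follows the least hypothesis
  not refuted yet.\<close>

section \<open>Computable functions on coded types\<close>

text \<open>The measure named by a weak learner need not belong to the class; all that is known is
  that one \<open>X\<close> is random for it. So nothing but the atom of its projection at
  \<open>Z\<close> can be exploited, and the fair even bits, which make the measure continuous, have
  to be supplied by averaging. In the EX case the obstacle is that being an index of a measure is
  not a condition that finite evidence refutes. The learner does not test it: a set of positive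
  measure on which the outputs stay at \<open>e\<close> contains a random real, and there the
  success of the given learner says that \<open>e\<close> is an index. What remains to be tested is
  co-enumerable, given the prefixes of \<open>Z\<close>. In the BC case the index may keep changing,
  and unreliable indices may vote for both values of a bit; they do no harm because the reliable
  ones alone form a strict majority, so that a wrong value never wins.\<close>

lemma recf_eval_Comp:
  assumes "list_all2 (\<lambda>g y. recf_eval g xs = Some y) gs ys"
  shows "recf_eval (Comp f gs) xs = recf_eval f ys"
proof -
  have "map (\<lambda>g. recf_eval g xs) gs = map Some ys"
    using assms by (induction) auto
  then have "map (\<lambda>g. g xs) (map recf_eval gs) = map Some ys"
    by (simp add: comp_def)
  moreover have "None \<notin> set (map Some ys)" "map the (map Some ys) = ys"
    by (auto simp: comp_def)
  ultimately show ?thesis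
    by (simp add: Let_def del: set_map map_map)
qed

section \<open>Arithmetic by programs on argument lists of a fixed length\<close>

definition recf_total :: "nat \<Rightarrow> (nat list \<Rightarrow> nat) \<Rightarrow> bool" where
  "recf_total k f \<longleftrightarrow> (\<exists>r. \<forall>xs. length xs = k \<longrightarrow> recf_eval r xs = Some (f xs))"

lemma recf_total_const: "recf_total k (\<lambda>xs. c)"
proof (induction c)
  case 0
  have "recf_eval Zero xs = Some 0" for xs by simp
  then show ?case unfolding recf_total_def by blast
next
  case (Suc c)
  then obtain r where r: "\<And>xs. length xs = k \<Longrightarrow> recf_eval r xs = Some c"
    unfolding recf_total_def by blast
  have "recf_eval (Comp Succ [r]) xs = Some (Suc c)" if "length xs = k" for xs
    using recf_eval_Comp[of xs "[r]" "[c]" Succ] r[OF that] by simp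
  then show ?case unfolding recf_total_def by blast
qed

lemma recf_total_nth: "i < k \<Longrightarrow> recf_total k (\<lambda>xs. xs ! i)"
  unfolding recf_total_def by (rule exI[of _ "Proj i"]) simp

lemma recf_total_Comp:
  assumes f: "recf_total (length gs) f" and gs: "\<And>g. g \<in> set gs \<Longrightarrow> recf_total k g"
  shows "recf_total k (\<lambda>xs. f (map (\<lambda>g. g xs) gs))"
proof -
  have "\<exists>rs. list_all2 (\<lambda>r g. \<forall>xs. length xs = k \<longrightarrow> recf_eval r xs = Some (g xs)) rs gs"
    using gs
  proof (induction gs)
    case (Cons g gs)
    then obtain rs where "list_all2 (\<lambda>r g. \<forall>xs. length xs = k \<longrightarrow> recf_eval r xs = Some (g xs)) rs gs"
      by auto
    moreover obtain r where "\<forall>xs. length xs = k \<longrightarrow> recf_eval r xs = Some (g xs)"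
      using Cons.prems[of g] unfolding recf_total_def by auto
    ultimately show ?case
      by (intro exI[of _ "r # rs"]) simp
  qed auto
  then obtain rs where rs:
      "list_all2 (\<lambda>r g. \<forall>xs. length xs = k \<longrightarrow> recf_eval r xs = Some (g xs)) rs gs"
    by blast
  obtain r where r: "\<And>xs. length xs = length gs \<Longrightarrow> recf_eval r xs = Some (f xs)"
    using f unfolding recf_total_def by blast
  have "recf_eval (Comp r rs) xs = Some (f (map (\<lambda>g. g xs) gs))" if "length xs = k" for xs
  proof -
    have "list_all2 (\<lambda>r y. recf_eval r xs = Some y) rs (map (\<lambda>g. g xs) gs)"
      using rs that unfolding list_all2_map2 by (auto elim: list_all2_mono)
    then show ?thesis
      by (simp add: recf_eval_Comp r del: recf_eval.simps)
  qed
  then show ?thesis unfolding recf_total_def by blast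
qed

lemma recf_total_Suc: "recf_total k f \<Longrightarrow> recf_total k (\<lambda>xs. Suc (f xs))"
proof -
  assume f: "recf_total k f"
  have "recf_total (length [f]) (\<lambda>xs. Suc (hd xs))"
    unfolding recf_total_def by (rule exI[of _ Succ]) (auto simp: length_Suc_conv)
  from recf_total_Comp[OF this, of k] f show ?thesis by simp
qed

text \<open>In the step of a primitive recursion the counter and the previous value stand before the
  parameters; this makes functions of the parameters available there.\<close>

lemma recf_total_drop2: "recf_total k f \<Longrightarrow> recf_total (Suc (Suc k)) (\<lambda>xs. f (drop 2 xs))"
proof -
  assume f: "recf_total k f"
  have "recf_total (Suc (Suc k)) (\<lambda>xs. f (map (\<lambda>g. g xs) (map (\<lambda>i xs. xs ! (i + 2)) [0..<k])))"
    by (rule recf_total_Comp) (use f in \<open>auto intro: recf_total_nth\<close>)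
  moreover have "map (\<lambda>g. g xs) (map (\<lambda>i xs. xs ! (i + 2)) [0..<k]) = drop 2 xs"
    if "length xs = Suc (Suc k)" for xs :: "nat list"
    by (rule nth_equalityI) (use that in \<open>auto simp: add.commute\<close>)
  ultimately show ?thesis unfolding recf_total_def by simp
qed

text \<open>\<open>PrimRec\<close> counts on its first argument. Feeding it \<open>rn\<close>
  followed by all projections lets the number of rounds be any function of the parameters.\<close>

lemma recf_total_rec_nat:
  assumes "recf_total k n" "recf_total k a" "recf_total (Suc (Suc k)) b"
  shows "recf_total k (\<lambda>xs. rec_nat (a xs) (\<lambda>i v. b (i # v # xs)) (n xs))"
proof -
  obtain ra rb rn where
    ra: "\<And>xs. length xs = k \<Longrightarrow> recf_eval ra xs = Some (a xs)" and
    rb: "\<And>xs. length xs = Suc (Suc k) \<Longrightarrow> recf_eval rb xs = Some (b xs)" and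
    rn: "\<And>xs. length xs = k \<Longrightarrow> recf_eval rn xs = Some (n xs)"
    using assms unfolding recf_total_def by blast
  have eval: "recf_eval (PrimRec ra rb) (m # xs) = Some (rec_nat (a xs) (\<lambda>i v. b (i # v # xs)) m)"
    if "length xs = k" for m xs
    by (induction m) (use that ra rb in auto)
  have "recf_eval (Comp (PrimRec ra rb) (rn # map Proj [0..<k])) xs =
      Some (rec_nat (a xs) (\<lambda>i v. b (i # v # xs)) (n xs))" if xs: "length xs = k" for xs
  proof -
    have "list_all2 (\<lambda>g y. recf_eval g xs = Some y) (rn # map Proj [0..<k]) (n xs # xs)"
      using xs rn by (auto simp: list_all2_conv_all_nth nth_Cons split: nat.split)
    then have "recf_eval (Comp (PrimRec ra rb) (rn # map Proj [0..<k])) xs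
        = recf_eval (PrimRec ra rb) (n xs # xs)"
      by (rule recf_eval_Comp)
    then show ?thesis using eval[OF xs] by (simp del: recf_eval.simps)
  qed
  then show ?thesis unfolding recf_total_def by blast
qed

lemma recf_total_add:
  assumes "recf_total k f" "recf_total k g" shows "recf_total k (\<lambda>xs. f xs + g xs)"
proof -
  have "rec_nat m (\<lambda>i v. Suc v) n = n + m" for m n by (induction n) auto
  then show ?thesis
    using recf_total_rec_nat[OF assms recf_total_Suc[OF recf_total_nth[of 1]]] by simp
qed

lemma recf_total_mult:
  assumes "recf_total k f" "recf_total k g" shows "recf_total k (\<lambda>xs. f xs * g xs)"
proof -
  have "rec_nat 0 (\<lambda>i v. v + m) n = n * m" for m n :: nat by (induction n) auto
  then show ?thesis
    using recf_total_rec_nat[OF assms(1) recf_total_const[of _ 0] recf_total_add[OF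
        recf_total_nth[of 1] recf_total_drop2[OF assms(2)]]]
    by simp
qed

lemma recf_total_pred:
  assumes "recf_total k f" shows "recf_total k (\<lambda>xs. f xs - 1)"
proof -
  have "rec_nat 0 (\<lambda>i v. i) n = n - 1" for n :: nat by (cases n) auto
  then show ?thesis
    using recf_total_rec_nat[OF assms recf_total_const[of _ 0] recf_total_nth[of 0]] by simp
qed

lemma recf_total_diff:
  assumes "recf_total k f" "recf_total k g" shows "recf_total k (\<lambda>xs. f xs - g xs)"
proof -
  have "rec_nat m (\<lambda>i v. v - 1) n = m - n" for m n :: nat by (induction n) auto
  then show ?thesis
    using recf_total_rec_nat[OF assms(2,1) recf_total_pred[OF recf_total_nth[of 1]]] by simp
qed

lemma recf_total_if_zero:
  assumes "recf_total k c" "recf_total k f" "recf_total k g"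
  shows "recf_total k (\<lambda>xs. if c xs = 0 then f xs else g xs)"
proof -
  have "rec_nat a (\<lambda>i v. b) n = (if n = 0 then a else b)" for a b n :: nat by (cases n) auto
  then show ?thesis
    using recf_total_rec_nat[OF assms(1,2) recf_total_drop2[OF assms(3)]] by simp
qed

lemma recf_total_triangle:
  assumes "recf_total k f" shows "recf_total k (\<lambda>xs. triangle (f xs))"
proof -
  have "rec_nat 0 (\<lambda>i v. v + Suc i) n = triangle n" for n :: nat by (induction n) auto
  then show ?thesis
    using recf_total_rec_nat[OF assms recf_total_const[of _ 0] recf_total_add[OF recf_total_nth[of
        1] recf_total_Suc[OF recf_total_nth[of 0]]]]
    by simp
qed

lemma recf_total_prod_encode:
  assumes "recf_total k f" "recf_total k g" shows "recf_total k (\<lambda>xs. prod_encode (f xs, g xs))"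
  using recf_total_add[OF recf_total_triangle[OF recf_total_add[OF assms]] assms(1)] by (simp add:
      prod_encode_def)

text \<open>The triangular root: the largest \<open>t\<close> with
  \<open>triangle t \<le> z\<close>, found by counting. On the code of \<open>(a, b)\<close> it is
  \<open>a + b\<close>, which is what inverting \<open>prod_encode\<close> by arithmetic takes;
  \<open>z\<close> rounds suffice since \<open>t \<le> triangle t\<close>.\<close>

definition troot :: "nat \<Rightarrow> nat" where
  "troot z = rec_nat 0 (\<lambda>i v. if triangle (Suc i) - z = 0 then v + 1 else v) z"

lemma recf_total_troot:
  assumes "recf_total k f" shows "recf_total k (\<lambda>xs. troot (f xs))"
  unfolding troot_def
  using recf_total_rec_nat[OF assms recf_total_const[of _ 0] recf_total_if_zero[OF
      recf_total_diff[OF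
     recf_total_triangle[OF recf_total_Suc[OF recf_total_nth[of 0]]] recf_total_drop2[OF assms]]
     recf_total_add[OF recf_total_nth[of 1] recf_total_const[of _ 1]] recf_total_nth[of 1]]]
  by (simp del: triangle_Suc cong: if_cong)

lemma triangle_mono: "i \<le> j \<Longrightarrow> triangle i \<le> triangle j"
  by (induction j rule: dec_induct) auto

lemma troot_prod_encode: "troot (prod_encode (a, b)) = a + b"
proof -
  define z t where "z = prod_encode (a, b)" and "t = a + b"
  have z: "z = triangle t + a" "a \<le> t" by (simp_all add: z_def t_def prod_encode_def)
  have le: "triangle i \<le> z \<longleftrightarrow> i \<le> t" for i
    using triangle_mono[of i t] triangle_mono[of "Suc t" i] z by (cases "i \<le> t") auto
  have "rec_nat 0 (\<lambda>i v. if triangle (Suc i) - z = 0 then v + 1 else v) n = min n t" for n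
    by (induction n) (auto simp del: triangle_Suc simp: le)
  moreover have "t \<le> triangle t" by (induction t) auto
  ultimately show ?thesis using z unfolding troot_def z_def[symmetric] t_def[symmetric] by simp
qed

lemma fst_prod_decode: "fst (prod_decode z) = z - triangle (troot z)"
  and snd_prod_decode: "snd (prod_decode z) = troot z - (z - triangle (troot z))"
proof -
  obtain a b where z: "z = prod_encode (a, b)" by (metis prod_decode_inverse surj_pair)
  show "fst (prod_decode z) = z - triangle (troot z)"
    "snd (prod_decode z) = troot z - (z - triangle (troot z))"
    unfolding z troot_prod_encode prod_encode_inverse by (simp_all add: prod_encode_def)
qed

section \<open>Types with codes and computable functions between them\<close>

class coded =
  fixes code :: "'a \<Rightarrow> nat"
  assumes inj_code: "inj code"

lemma code_eq_iff [simp]: "code x = code y \<longleftrightarrow> x = y"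
  using inj_code by (auto dest: injD)

instantiation nat :: coded begin
definition "code (n :: nat) = n"
instance by standard (simp add: code_nat_def inj_def)
end

instantiation bool :: coded begin
definition "code (b :: bool) = of_bool b"
instance by standard (simp add: code_bool_def inj_def)
end

instantiation prod :: (coded, coded) coded begin
definition "code p = prod_encode (code (fst p), code (snd p))"
instance by standard (simp add: code_prod_def inj_def prod_eq_iff)
end

instantiation option :: (coded) coded begin
definition "code x = (case x of None \<Rightarrow> 0 | Some y \<Rightarrow> Suc (code y))"
instance by standard (simp add: code_option_def inj_def split: option.split)
end

instantiation list :: (coded) coded begin
definition "code xs = list_encode (map code xs)"
instance
  by standard (auto simp: code_list_def inj_def list_encode_eq inj_code inj_map_eq_map)
end

lemma code_Nil [simp]: "code ([] :: 'a :: coded list) = 0"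
  and code_Cons: "code (x # xs) = Suc (prod_encode (code x, code xs))"
  by (simp_all add: code_list_def)

lemma code_bool_list: "code \<sigma> = str_code \<sigma>"
  by (simp add: code_list_def str_code_def code_bool_def [abs_def])

text \<open>Nothing is asked of the program on numbers that are not codes, so injectivity of
  \<open>code\<close> is all that a type has to provide.\<close>

definition computable :: "('a :: coded \<Rightarrow> 'b :: coded) \<Rightarrow> bool" where
  "computable f \<longleftrightarrow> (\<exists>r. \<forall>x. recf_eval r [code x] = Some (code (f x)))"

lemma computable_fun_iff: "computable_fun f \<longleftrightarrow> computable f"
  by (simp add: computable_fun_def computable_def code_nat_def)

lemma computable_learner_iff: "computable_learner L \<longleftrightarrow> computable L"
  by (simp add: computable_learner_def computable_def code_nat_def code_bool_list)

lemma computable_real_iff: "computable_real Z \<longleftrightarrow> computable Z"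
  by (simp add: computable_real_def computable_def code_nat_def code_bool_def)

named_theorems computable_intros

lemma computable_app:
  assumes "computable f" "computable g" shows "computable (\<lambda>x. f (g x))"
proof -
  obtain rf rg where rf: "\<And>x. recf_eval rf [code x] = Some (code (f x))"
    and rg: "\<And>x. recf_eval rg [code x] = Some (code (g x))"
    using assms unfolding computable_def by blast
  have "recf_eval (Comp rf [rg]) [code x] = Some (code (f (g x)))" for x
    using recf_eval_Comp[of "[code x]" "[rg]" "[code (g x)]" rf] rf rg by simp
  then show ?thesis unfolding computable_def by blast
qed

text \<open>The bridge from arithmetic to coded types: it suffices that the code of the value is an
  arithmetic function of numbers computed from \<open>x\<close>, in practice of the codes of the
  arguments.\<close>

lemma computable_recf_total:
  fixes f :: "'a :: coded \<Rightarrow> 'b :: coded"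
  assumes f: "recf_total (length gs) F" and gs: "\<And>g. g \<in> set gs \<Longrightarrow> computable (g :: 'a \<Rightarrow> nat)"
    and eq: "\<And>x. code (f x) = F (map (\<lambda>g. g x) gs)"
  shows "computable f"
proof -
  have "\<exists>rs. list_all2 (\<lambda>r g. \<forall>x. recf_eval r [code x] = Some (g x)) rs gs"
    using gs
  proof (induction gs)
    case (Cons g gs)
    then obtain rs where "list_all2 (\<lambda>r g. \<forall>x. recf_eval r [code x] = Some (g x)) rs gs"
      by auto
    moreover obtain r where "\<forall>x. recf_eval r [code x] = Some (g x)"
      using Cons.prems[of g] unfolding computable_def by (auto simp: code_nat_def)
    ultimately show ?case by (intro exI[of _ "r # rs"]) simp
  qed auto
  then obtain rs where rs: "list_all2 (\<lambda>r g. \<forall>x. recf_eval r [code x] = Some (g x)) rs gs"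
    by blast
  obtain r where r: "\<And>xs. length xs = length gs \<Longrightarrow> recf_eval r xs = Some (F xs)"
    using f unfolding recf_total_def by blast
  have "recf_eval (Comp r rs) [code x] = Some (code (f x))" for x
  proof -
    have "list_all2 (\<lambda>r y. recf_eval r [code x] = Some y) rs (map (\<lambda>g. g x) gs)"
      using rs unfolding list_all2_map2 by (auto elim: list_all2_mono)
    then show ?thesis
      by (simp add: recf_eval_Comp r eq del: recf_eval.simps)
  qed
  then show ?thesis unfolding computable_def by blast
qed

lemma computable_code: "computable f \<Longrightarrow> computable (\<lambda>x. code (f x))"
  by (simp add: computable_def code_nat_def)

lemma computable_recf_total1:
  assumes "recf_total 1 F" "computable g" "\<And>x. code (f x) = F [code (g x)]"
  shows "computable f"
  by (rule computable_recf_total[of "[\<lambda>x. code (g x)]" F]) (use assms computable_code in auto)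

lemma computable_recf_total2:
  assumes "recf_total 2 F" "computable g" "computable h"
      "\<And>x. code (f x) = F [code (g x), code (h x)]"
  shows "computable f"
  by (rule computable_recf_total[of "[\<lambda>x. code (g x), \<lambda>x. code (h x)]" F])
     (use assms computable_code[of g] computable_code[of h] in \<open>auto simp: numeral_2_eq_2\<close>)

lemma computable_recf_total3:
  assumes "recf_total 3 F" "computable g" "computable h" "computable i"
    "\<And>x. code (f x) = F [code (g x), code (h x), code (i x)]"
  shows "computable f"
  by (rule computable_recf_total[of "[\<lambda>x. code (g x), \<lambda>x. code (h x), \<lambda>x. code (i x)]" F])
     (use assms computable_code[of g] computable_code[of h] computable_code[of i] in
       \<open>auto simp: numeral_3_eq_3\<close>)

lemma computable_const [computable_intros]: "computable (\<lambda>x. c)"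
  by (rule computable_recf_total[of "[]" "\<lambda>xs. code c"]) (auto intro: recf_total_const)

lemma computable_id [computable_intros]: "computable (\<lambda>x. x)"
  unfolding computable_def by (rule exI[of _ "Proj 0"]) simp

lemma computable_Pair [computable_intros]:
  "computable f \<Longrightarrow> computable g \<Longrightarrow> computable (\<lambda>x. (f x, g x))"
  by (rule computable_recf_total2[OF recf_total_prod_encode[OF recf_total_nth[of 0]
      recf_total_nth[of 1]]])
     (auto simp: code_prod_def)

lemma computable_fst [computable_intros]: "computable f \<Longrightarrow> computable (\<lambda>x. fst (f x))"
proof (rule computable_recf_total1)
  show "recf_total 1 (\<lambda>xs. fst (prod_decode (xs ! 0)))"
    unfolding fst_prod_decode by (intro recf_total_diff recf_total_triangle recf_total_troot
        recf_total_nth) auto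
qed (auto simp: code_prod_def)

lemma computable_snd [computable_intros]: "computable f \<Longrightarrow> computable (\<lambda>x. snd (f x))"
proof (rule computable_recf_total1)
  show "recf_total 1 (\<lambda>xs. snd (prod_decode (xs ! 0)))"
    unfolding snd_prod_decode by (intro recf_total_diff recf_total_triangle recf_total_troot
        recf_total_nth) auto
qed (auto simp: code_prod_def)

lemma computable_Suc [computable_intros]: "computable f \<Longrightarrow> computable (\<lambda>x. Suc (f x))"
  by (rule computable_recf_total1[OF recf_total_Suc[OF recf_total_nth[of 0]]]) (auto simp:
      code_nat_def)

lemma computable_add [computable_intros]:
  fixes f g :: "'a :: coded \<Rightarrow> nat"
  shows "computable f \<Longrightarrow> computable g \<Longrightarrow> computable (\<lambda>x. f x + g x)"
  by (rule computable_recf_total2[OF recf_total_add[OF recf_total_nth[of 0] recf_total_nth[of 1]],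
      of f g]) (auto simp: code_nat_def)

lemma computable_mult [computable_intros]:
  fixes f g :: "'a :: coded \<Rightarrow> nat"
  shows "computable f \<Longrightarrow> computable g \<Longrightarrow> computable (\<lambda>x. f x * g x)"
  by (rule computable_recf_total2[OF recf_total_mult[OF recf_total_nth[of 0] recf_total_nth[of
      1]], of f g]) (auto simp: code_nat_def)

lemma computable_diff [computable_intros]:
  fixes f g :: "'a :: coded \<Rightarrow> nat"
  shows "computable f \<Longrightarrow> computable g \<Longrightarrow> computable (\<lambda>x. f x - g x)"
  by (rule computable_recf_total2[OF recf_total_diff[OF recf_total_nth[of 0] recf_total_nth[of
      1]], of f g]) (auto simp: code_nat_def)

lemma computable_if [computable_intros]:
  assumes "computable c" "computable f" "computable g"
  shows "computable (\<lambda>x. if c x then f x else g x)"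
  by (rule computable_recf_total3[OF recf_total_if_zero[OF recf_total_nth[of 0] recf_total_nth[of
      2] recf_total_nth[of 1]] assms])
     (auto simp: code_bool_def)

text \<open>Codes are injective, so codes are compared. With truncated subtraction the sum of the
  two differences is the distance of the codes.\<close>

lemma computable_eq [computable_intros]:
  assumes "computable f" "computable g"
  shows "computable (\<lambda>x. f x = g x)"
proof (rule computable_recf_total2[OF _ assms])
  show "recf_total 2 (\<lambda>xs. 1 - ((xs ! 0 - xs ! 1) + (xs ! 1 - xs ! 0)))"
    by (intro recf_total_diff recf_total_add recf_total_const recf_total_nth) auto
  show "code (f x = g x) = 1 - (([code (f x), code (g x)] ! 0 - [code (f x), code (g x)] ! 1)
      + ([code (f x), code (g x)] ! 1 - [code (f x), code (g x)] ! 0))" for x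
    using code_eq_iff[of "f x" "g x"] by (auto simp: code_bool_def simp del: code_eq_iff)
qed

lemma computable_less [computable_intros]:
  fixes f g :: "'a :: coded \<Rightarrow> nat"
  assumes "computable f" "computable g"
  shows "computable (\<lambda>x. f x < g x)"
  by (rule computable_recf_total2[OF _ assms, of "\<lambda>xs. 1 - (1 - (xs ! 1 - xs ! 0))"])
     (auto simp: code_bool_def code_nat_def intro!: recf_total_diff recf_total_const recf_total_nth)

lemma computable_le [computable_intros]:
  fixes f g :: "'a :: coded \<Rightarrow> nat"
  assumes "computable f" "computable g"
  shows "computable (\<lambda>x. f x \<le> g x)"
  using computable_less[OF assms(1) computable_Suc[OF assms(2)]] by (simp add: less_Suc_eq_le)

lemma computable_not [computable_intros]:
  "computable f \<Longrightarrow> computable (\<lambda>x. \<not> f x)"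
  using computable_if[OF _ computable_const[of False] computable_const[of True], of f]
  by (rule back_subst[of computable]) auto

lemma computable_conj [computable_intros]:
  assumes "computable f" "computable g" shows "computable (\<lambda>x. f x \<and> g x)"
  using computable_if[OF assms computable_const[of False]] by (rule back_subst[of computable]) auto

lemma computable_disj [computable_intros]:
  assumes "computable f" "computable g" shows "computable (\<lambda>x. f x \<or> g x)"
  using computable_if[OF assms(1) computable_const[of True] assms(2)] by (rule back_subst[of
      computable]) auto

lemma computable_imp [computable_intros]:
  assumes "computable f" "computable g" shows "computable (\<lambda>x. f x \<longrightarrow> g x)"
  using computable_if[OF assms computable_const[of True]] by (rule back_subst[of computable]) auto

lemma computable_of_bool [computable_intros]:
  "computable f \<Longrightarrow> computable (\<lambda>x. of_bool (f x) :: nat)"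
  unfolding of_bool_def by (intro computable_intros)

lemma prod_encode_recf: "\<exists>r. \<forall>a b. recf_eval r [a, b] = Some (prod_encode (a, b))"
proof -
  have "recf_total 2 (\<lambda>xs. prod_encode (xs ! 0, xs ! 1))"
    by (intro recf_total_prod_encode recf_total_nth) auto
  then obtain r where "\<And>xs. length xs = 2 \<Longrightarrow> recf_eval r xs = Some (prod_encode (xs ! 0, xs ! 1))"
    unfolding recf_total_def by blast
  then have "recf_eval r [a, b] = Some (prod_encode (a, b))" for a b
    by simp
  then show ?thesis by blast
qed

lemma computable_rec_nat [computable_intros]:
  fixes a :: "'a :: coded \<Rightarrow> 'b :: coded"
  assumes n: "computable n" and a: "computable a"
    and b: "computable (\<lambda>t. b (fst t) (fst (snd t)) (snd (snd t)))"
  shows "computable (\<lambda>x. rec_nat (a x) (b x) (n x))"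
proof -
  obtain rn ra rb rp where rn: "\<And>x. recf_eval rn [code x] = Some (n x)"
    and ra: "\<And>x. recf_eval ra [code x] = Some (code (a x))"
    and rb: "\<And>x k v. recf_eval rb [code (x, k, v)] = Some (code (b x k v))"
    and rp: "\<And>a b. recf_eval rp [a, b] = Some (prod_encode (a, b))"
    using n a b prod_encode_recf unfolding computable_def by (fastforce simp: code_nat_def)
  \<comment> \<open>\<open>PrimRec\<close> passes counter, value and parameter in this order, while
    \<open>rb\<close> expects the code of the triple parameter, counter, value.\<close>
  define rs where "rs = Comp rb [Comp rp [Proj 2, Comp rp [Proj 0, Proj 1]]]"
  have rs: "recf_eval rs [k, code v, code x] = Some (code (b x k v))" for k x v
    using rb rp by (simp add: rs_def code_prod_def code_nat_def)
  have eval: "recf_eval (PrimRec ra rs) [m, code x] = Some (code (rec_nat (a x) (b x) m))" for m x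
    by (induction m) (use ra rs in auto)
  have "recf_eval (Comp (PrimRec ra rs) [rn, Proj 0]) [code x] = Some (code (rec_nat (a x) (b x) (n x)))" for x
    using recf_eval_Comp[of "[code x]" "[rn, Proj 0]" "[n x, code x]" "PrimRec ra rs"] rn eval
    by simp
  then show ?thesis unfolding computable_def by blast
qed

text \<open>The only place where a program with \<open>Mu\<close> is built; enumerable sets and
  partial functions below are all obtained from this search.\<close>

lemma search_recf:
  fixes P :: "'a :: coded \<times> nat \<Rightarrow> bool"
  assumes "computable P"
  shows "\<exists>r. \<forall>x. recf_eval r [code x] =
    (if \<exists>s. P (x, s) then Some (LEAST s. P (x, s)) else None)"
proof -
  have "computable (\<lambda>t. of_bool (\<not> P t) :: nat)"
    by (intro computable_intros computable_app[OF assms])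
  then obtain rq rp where rq: "\<And>x s. recf_eval rq [code (x, s)] = Some (of_bool (\<not> P (x, s)))"
    and rp: "\<And>a b. recf_eval rp [a, b] = Some (prod_encode (a, b))"
    using prod_encode_recf unfolding computable_def by (fastforce simp: code_nat_def)
  \<comment> \<open>\<open>Mu\<close> looks for a zero, hence the negated \<open>P\<close>; its
    search argument comes first, hence the exchanged projections.\<close>
  define r where "r = Mu (Comp rq [Comp rp [Proj 1, Proj 0]])"
  have ev: "recf_eval (Comp rq [Comp rp [Proj 1, Proj 0]]) [s, code x] = Some (of_bool (\<not> P (x, s)))" for s x
    using rq rp by (simp add: code_prod_def code_nat_def)
  have "recf_eval r [code x] = (if \<exists>s. P (x, s) then Some (LEAST s. P (x, s)) else None)" for x
  proof -
    define Q where "Q = (\<lambda>n. P (x, n) \<and> (\<forall>m<n. \<not> P (x, m)))"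
    have Q: "Q = (\<lambda>n. (recf_eval (Comp rq [Comp rp [Proj 1, Proj 0]]) [n, code x] = Some 0 \<and>
        (\<forall>m<n. \<exists>v. recf_eval (Comp rq [Comp rp [Proj 1, Proj 0]]) [m, code x] = Some (Suc v))))"
      unfolding ev Q_def by (auto simp: fun_eq_iff)
    have "recf_eval r [code x] = (if \<exists>n. Q n then Some (THE n. Q n) else None)"
      unfolding r_def recf_eval.simps(6) Let_def Q ..
    moreover have "(\<exists>n. Q n) \<longleftrightarrow> (\<exists>s. P (x, s))"
      unfolding Q_def using exists_least_iff[of "\<lambda>s. P (x, s)"] by blast
    moreover have "(THE n. Q n) = (LEAST s. P (x, s))" if "P (x, s)" for s
    proof (rule the_equality)
      show "Q (LEAST s. P (x, s))" unfolding Q_def using LeastI[of "\<lambda>s. P (x, s)", OF that]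
          not_less_Least by blast
      show "n = (LEAST s. P (x, s))" if "Q n" for n
        using that unfolding Q_def by (metis LeastI_ex Least_le linorder_not_less
            order_antisym_conv)
    qed
    ultimately show ?thesis by auto
  qed
  then show ?thesis by blast
qed

section \<open>Lists, loops and options\<close>

lemma computable_app2:
  assumes "computable (\<lambda>t. f (fst t) (snd t))" "computable g" "computable h"
  shows "computable (\<lambda>x. f (g x) (h x))"
  using computable_app[OF assms(1) computable_Pair[OF assms(2,3)]] by simp

lemma computable_app3:
  assumes "computable (\<lambda>t. f (fst t) (fst (snd t)) (snd (snd t)))"
    "computable g" "computable h" "computable k"
  shows "computable (\<lambda>x. f (g x) (h x) (k x))"
  using computable_app[OF assms(1) computable_Pair[OF assms(2) computable_Pair[OF assms(3,4)]]] by
      simp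

text \<open>\<open>!\<close> has no specified value beyond the end of the list, so list access is
  made an option; \<open>the_or\<close> likewise gives \<open>the\<close> a definite
  default.\<close>

definition lookup :: "'a list \<Rightarrow> nat \<Rightarrow> 'a option" where
  "lookup xs i = (if i < length xs then Some (xs ! i) else None)"

definition the_or :: "'a \<Rightarrow> 'a option \<Rightarrow> 'a" where
  "the_or d x = (case x of None \<Rightarrow> d | Some y \<Rightarrow> y)"

lemma computable_Some [computable_intros]: "computable f \<Longrightarrow> computable (\<lambda>x. Some (f x))"
  by (rule computable_recf_total1[OF recf_total_Suc[OF recf_total_nth[of 0]]]) (auto simp:
      code_option_def)

lemma computable_the_or [computable_intros]:
  assumes "computable f" shows "computable (\<lambda>x. the_or d (f x))"
  by (rule computable_recf_total1[OF recf_total_if_zero[OF recf_total_nth[of 0]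
      recf_total_const[of _ "code d"]
        recf_total_pred[OF recf_total_nth[of 0]]] assms])
     (auto simp: code_option_def the_or_def split: option.split)

lemma computable_case_option [computable_intros]:
  assumes "computable f" "computable a" and b: "computable (\<lambda>t. b (fst t) (snd t))"
  shows "computable (\<lambda>x. case f x of None \<Rightarrow> a x | Some y \<Rightarrow> b x y)"
proof -
  \<comment> \<open>Here \<open>undefined\<close> is just some fixed constant: for
    \<open>None\<close> the branch that receives it is discarded.\<close>
  have "computable (\<lambda>x. if f x = None then a x else b x (the_or undefined (f x)))"
    using computable_app[OF b computable_Pair[OF computable_id
        computable_the_or[OF assms(1), of undefined]]]
    by (intro computable_intros assms) simp
  moreover have "(if f x = None then a x else b x (the_or undefined (f x))) =
      (case f x of None \<Rightarrow> a x | Some y \<Rightarrow> b x y)" for x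
    by (auto simp: the_or_def)
  ultimately show ?thesis by simp
qed

lemma computable_Cons [computable_intros]:
  "computable f \<Longrightarrow> computable g \<Longrightarrow> computable (\<lambda>x. f x # g x)"
  by (rule computable_recf_total2[OF recf_total_Suc[OF recf_total_prod_encode[OF recf_total_nth[of
      0] recf_total_nth[of 1]]], of f g])
     (auto simp: code_Cons)

lemma computable_lookup_0:
  assumes "computable f" shows "computable (\<lambda>x. lookup (f x) 0)"
proof (rule computable_recf_total1[OF _ assms])
  show "recf_total 1 (\<lambda>xs. if xs ! 0 = 0 then 0 else Suc (fst (prod_decode (xs ! 0 - 1))))"
    unfolding fst_prod_decode
    by (intro recf_total_if_zero recf_total_const recf_total_Suc recf_total_pred recf_total_diff
        recf_total_triangle recf_total_troot recf_total_nth) auto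
  show "code (lookup (f x) 0) = (if [code (f x)] ! 0 = 0 then 0 else Suc (fst (prod_decode ([code (f x)] ! 0 - 1))))"
    for x by (cases "f x") (auto simp: lookup_def code_option_def code_Cons)
qed

lemma computable_tl [computable_intros]:
  assumes "computable f" shows "computable (\<lambda>x. tl (f x))"
proof (rule computable_recf_total1[OF _ assms])
  show "recf_total 1 (\<lambda>xs. if xs ! 0 = 0 then 0 else snd (prod_decode (xs ! 0 - 1)))"
    unfolding snd_prod_decode
    by (intro recf_total_if_zero recf_total_const recf_total_Suc recf_total_pred recf_total_diff
        recf_total_triangle recf_total_troot recf_total_nth) auto
  show "code (tl (f x)) = (if [code (f x)] ! 0 = 0 then 0 else snd (prod_decode ([code (f x)] ! 0 - 1)))"
    for x by (cases "f x") (auto simp: code_Cons)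
qed

lemma computable_lookup [computable_intros]:
  assumes "computable f" "computable i" shows "computable (\<lambda>x. lookup (f x) (i x))"
proof -
  have "rec_nat xs (\<lambda>_. tl) n = drop n xs" for xs :: "'b list" and n
    by (induction n) (auto simp: drop_Suc tl_drop)
  moreover have "lookup (drop n xs) 0 = lookup xs n" for xs :: "'b list" and n
    by (auto simp: lookup_def)
  moreover have "computable (\<lambda>x. lookup (rec_nat (f x) (\<lambda>_. tl) (i x)) 0)"
    by (intro computable_lookup_0 computable_intros assms)
  ultimately show ?thesis by simp
qed

lemma length_le_code: "length xs \<le> code xs"
  by (induction xs) (auto simp: code_Cons intro: order_trans le_prod_encode_2)

text \<open>Primitive recursion runs over numbers, so the list is consumed from a state pair in
  \<open>code (l x)\<close> rounds. That is at least its length, and once the list is empty the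
  state stays as it is.\<close>

lemma computable_foldl [computable_intros]:
  assumes l: "computable l" and a: "computable a"
    and s: "computable (\<lambda>t. s (fst t) (fst (snd t)) (snd (snd t)))"
  shows "computable (\<lambda>x. foldl (s x) (a x) (l x))"
proof -
  define step where "step x st = (case lookup (snd st) 0 of None \<Rightarrow> st
      | Some y \<Rightarrow> (s x (fst st) y, tl (snd st)))" for x st
  have step: "rec_nat (b, xs) (\<lambda>_. step x) n = (foldl (s x) b (take n xs), drop n xs)" for b xs x n
    by (induction n) (auto simp: step_def lookup_def take_Suc_conv_app_nth drop_Suc tl_drop)
  have "fst (rec_nat (a x, l x) (\<lambda>_. step x) (code (l x))) = foldl (s x) (a x) (l x)" for x
    using length_le_code[of "l x"] by (simp add: step)
  moreover have "computable (\<lambda>x. fst (rec_nat (a x, l x) (\<lambda>_. step x) (code (l x))))"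
    unfolding step_def
    by (intro computable_intros computable_lookup_0 computable_code computable_app3[OF s]
        computable_app[OF l] computable_app[OF a] l a)
  ultimately show ?thesis by simp
qed

lemma computable_rev [computable_intros]:
  assumes "computable f" shows "computable (\<lambda>x. rev (f x))"
proof -
  have "foldl (\<lambda>acc y. y # acc) [] xs = rev xs" for xs :: "'b list"
    by (induction xs rule: rev_induct) auto
  moreover have "computable (\<lambda>x. foldl (\<lambda>acc y. y # acc) [] (f x))"
    by (intro computable_intros assms)
  ultimately show ?thesis by simp
qed

lemma computable_append [computable_intros]:
  assumes "computable f" "computable g" shows "computable (\<lambda>x. f x @ g x)"
proof -
  have "foldl (\<lambda>acc y. y # acc) ys (rev xs) = xs @ ys" for xs ys :: "'b list"
    by (induction xs) auto
  moreover have "computable (\<lambda>x. foldl (\<lambda>acc y. y # acc) (g x) (rev (f x)))"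
    by (intro computable_intros assms)
  ultimately show ?thesis by simp
qed

lemma computable_length [computable_intros]:
  assumes "computable f" shows "computable (\<lambda>x. length (f x))"
proof -
  have "foldl (\<lambda>n _. Suc n) 0 xs = length xs" for xs :: "'b list"
    by (induction xs rule: rev_induct) auto
  moreover have "computable (\<lambda>x. foldl (\<lambda>n _. Suc n) 0 (f x))"
    by (intro computable_intros assms)
  ultimately show ?thesis by simp
qed

lemma computable_take [computable_intros]:
  assumes "computable n" "computable f" shows "computable (\<lambda>x. take (n x) (f x))"
proof -
  have "foldl (\<lambda>acc y. if length acc < m then acc @ [y] else acc) [] xs = take m xs"
    for m and xs :: "'b list" by (induction xs rule: rev_induct) auto
  moreover have "computable (\<lambda>x. foldl (\<lambda>acc y. if length acc < n x then acc @ [y] else acc) [] (f x))"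
    by (intro computable_intros computable_app[OF assms(1)] assms)
  ultimately show ?thesis by simp
qed

lemma computable_filter [computable_intros]:
  assumes "computable f" "computable (\<lambda>t. P (fst t) (snd t))"
  shows "computable (\<lambda>x. filter (P x) (f x))"
proof -
  have "foldl (\<lambda>acc y. if Q y then acc @ [y] else acc) [] xs = filter Q xs"
    for Q and xs :: "'b list" by (induction xs rule: rev_induct) auto
  moreover have "computable (\<lambda>x. foldl (\<lambda>acc y. if P x y then acc @ [y] else acc) [] (f x))"
    by (intro computable_intros computable_app2[OF assms(2)] assms)
  ultimately show ?thesis by simp
qed

lemma computable_map_upt [computable_intros]:
  assumes "computable n" "computable (\<lambda>t. f (fst t) (snd t))"
  shows "computable (\<lambda>x. map (f x) [0..<n x])"
proof -
  have "rec_nat [] (\<lambda>k v. v @ [g k]) m = map g [0..<m]" for g :: "nat \<Rightarrow> 'b" and m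
    by (induction m) auto
  moreover have "computable (\<lambda>x. rec_nat [] (\<lambda>k v. v @ [f x k]) (n x))"
    by (intro computable_intros computable_app2[OF assms(2)] assms)
  ultimately show ?thesis by simp
qed

lemma computable_sum [computable_intros]:
  fixes f :: "'a :: coded \<Rightarrow> nat \<Rightarrow> nat"
  assumes "computable n" "computable (\<lambda>t. f (fst t) (snd t))"
  shows "computable (\<lambda>x. \<Sum>y<n x. f x y)"
proof -
  have "rec_nat 0 (\<lambda>k v. v + g k) m = (\<Sum>y<m. g y)" for g :: "nat \<Rightarrow> nat" and m
    by (induction m) auto
  moreover have "computable (\<lambda>x. rec_nat 0 (\<lambda>k v. v + f x k) (n x))"
    by (intro computable_intros computable_app2[OF assms(2)] assms)
  ultimately show ?thesis by simp
qed

lemma computable_All_less [computable_intros]: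
  fixes P :: "'a :: coded \<Rightarrow> nat \<Rightarrow> bool"
  assumes "computable n" "computable (\<lambda>t. P (fst t) (snd t))"
  shows "computable (\<lambda>x. \<forall>y<n x. P x y)"
proof -
  have "rec_nat True (\<lambda>k v. v \<and> Q k) m = (\<forall>y<m. Q y)" for Q :: "nat \<Rightarrow> bool" and m
    by (induction m) (auto simp: less_Suc_eq)
  moreover have "computable (\<lambda>x. rec_nat True (\<lambda>k v. v \<and> P x k) (n x))"
    by (intro computable_intros computable_app2[OF assms(2)] assms)
  ultimately show ?thesis by simp
qed

lemma computable_All_le [computable_intros]:
  fixes P :: "'a :: coded \<Rightarrow> nat \<Rightarrow> bool"
  assumes "computable n" "computable (\<lambda>t. P (fst t) (snd t))"
  shows "computable (\<lambda>x. \<forall>y\<le>n x. P x y)"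
  using computable_All_less[OF computable_Suc[OF assms(1)] assms(2)] by (simp add: less_Suc_eq_le)

lemma computable_Ex_less [computable_intros]:
  fixes P :: "'a :: coded \<Rightarrow> nat \<Rightarrow> bool"
  assumes "computable n" "computable (\<lambda>t. P (fst t) (snd t))"
  shows "computable (\<lambda>x. \<exists>y<n x. P x y)"
  using computable_not[OF computable_All_less[OF assms(1) computable_not[OF assms(2)]]] by simp

section \<open>Bounded search, powers and division\<close>

definition first_below :: "(nat \<Rightarrow> bool) \<Rightarrow> nat \<Rightarrow> nat" where
  "first_below P n = (if \<exists>m<n. P m then LEAST m. P m else n)"

lemma first_below_eqI: "k < n \<Longrightarrow> P k \<Longrightarrow> (\<And>m. m < k \<Longrightarrow> \<not> P m) \<Longrightarrow> first_below P n = k"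
  unfolding first_below_def by (metis Least_equality linorder_not_less)

lemma first_below_less:
  assumes "first_below P n < n"
  shows "P (first_below P n)" "m < first_below P n \<Longrightarrow> \<not> P m"
  using assms unfolding first_below_def by (auto split: if_splits intro: LeastI dest:
      not_less_Least)

lemma computable_first_below [computable_intros]:
  assumes "computable n" "computable (\<lambda>t. P (fst t) (snd t))"
  shows "computable (\<lambda>x. first_below (P x) (n x))"
proof -
  \<comment> \<open>The running value moves along with the counter until the first witness and is
    frozen from then on.\<close>
  have "rec_nat 0 (\<lambda>k v. if v = k \<and> \<not> Q k then Suc k else v) m = first_below Q m" for Q m
  proof (induction m)
    case (Suc m)
    show ?case
    proof (cases "\<exists>k<m. Q k")
      case True
      then have "(LEAST k. Q k) < m" by (meson Least_le le_less_trans)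
      with True show ?thesis by (auto simp: Suc first_below_def less_Suc_eq)
    next
      case False
      then show ?thesis
        by (auto simp: Suc first_below_def less_Suc_eq intro!: Least_equality[symmetric])
           (meson linorder_not_less)
    qed
  qed (simp add: first_below_def)
  moreover have "computable (\<lambda>x. rec_nat 0 (\<lambda>k v. if v = k \<and> \<not> P x k then Suc k else v) (n x))"
    by (intro computable_intros computable_app2[OF assms(2)] assms)
  ultimately show ?thesis by simp
qed

lemma computable_power [computable_intros]:
  fixes f g :: "'a :: coded \<Rightarrow> nat"
  assumes "computable f" "computable g" shows "computable (\<lambda>x. f x ^ g x)"
proof -
  have "rec_nat 1 (\<lambda>_ v. a * v) n = a ^ n" for a n :: nat by (induction n) auto
  moreover have "computable (\<lambda>x. rec_nat 1 (\<lambda>_ v. f x * v) (g x))"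
    by (intro computable_intros assms computable_app[OF assms(1)])
  ultimately show ?thesis by simp
qed

lemma computable_div [computable_intros]:
  fixes f g :: "'a :: coded \<Rightarrow> nat"
  assumes "computable f" "computable g" shows "computable (\<lambda>x. f x div g x)"
proof -
  \<comment> \<open>The quotient counts its positive lower bounds \<open>Suc q\<close>. For
    \<open>b = 0\<close> all \<open>q\<close> would be counted, whereas \<open>div\<close> gives
    0.\<close>
  have "(if b = 0 then 0 else \<Sum>q<a. of_bool (Suc q * b \<le> a)) = a div b" for a b :: nat
  proof (cases "b = 0")
    case False
    then have "Suc q * b \<le> a \<longleftrightarrow> q < a div b" for q
      using less_eq_div_iff_mult_less_eq[of b "Suc q" a] by (simp add: Suc_le_eq)
    moreover have "(\<Sum>q<m. of_bool (q < d)) = min m d" for m d :: nat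
      by (induction m) auto
    ultimately show ?thesis using False by (simp del: mult_Suc)
  qed auto
  moreover have "computable (\<lambda>x. if g x = 0 then 0 :: nat else \<Sum>q<f x. of_bool (Suc q * g x \<le> f x))"
    by (intro computable_intros assms computable_app[OF assms(1)] computable_app[OF assms(2)])
  ultimately show ?thesis by simp
qed

lemma computable_odd [computable_intros]:
  fixes f :: "'a :: coded \<Rightarrow> nat"
  assumes "computable f" shows "computable (\<lambda>x. odd (f x))"
proof -
  have "odd n \<longleftrightarrow> \<not> n = 2 * (n div 2)" for n :: nat by presburger
  then show ?thesis by (simp only:) (intro computable_intros assms)
qed

section \<open>Step-bounded evaluation\<close>

text \<open>The bound limits only the searches of \<open>Mu\<close>, as all other schemes terminate
  by themselves. The program is fixed whenever this is used, so the recursion over it takes place in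
  the logic, and computability in the other two arguments follows by induction without a universal
  program.\<close>

primrec eval_within :: "recf \<Rightarrow> nat \<Rightarrow> nat list \<Rightarrow> nat option" where
  "eval_within Zero = (\<lambda>s xs. Some 0)"
| "eval_within Succ = (\<lambda>s xs. case lookup xs 0 of None \<Rightarrow> None | Some x \<Rightarrow> Some (Suc x))"
| "eval_within (Proj i) = (\<lambda>s xs. lookup xs i)"
| "eval_within (Comp f gs) = (\<lambda>s xs. case those (map (\<lambda>g. g s xs) (map eval_within gs)) of
     None \<Rightarrow> None | Some ys \<Rightarrow> eval_within f s ys)"
| "eval_within (PrimRec f g) = (\<lambda>s xs. case lookup xs 0 of None \<Rightarrow> None
     | Some n \<Rightarrow> rec_nat (eval_within f s (tl xs))
         (\<lambda>k r. case r of None \<Rightarrow> None | Some v \<Rightarrow> eval_within g s (k # v # tl xs)) n)"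
| "eval_within (Mu f) = (\<lambda>s xs.
     if first_below (\<lambda>m. the_or 0 (eval_within f s (m # xs)) = 0) s < s \<and>
        eval_within f s (first_below (\<lambda>m. the_or 0 (eval_within f s (m # xs)) = 0) s # xs) = Some 0
     then Some (first_below (\<lambda>m. the_or 0 (eval_within f s (m # xs)) = 0) s) else None)"

lemma those_map_Some: "those (map Some ys) = Some ys"
  by (induction ys) auto

lemma those_SomeD: "those xs = Some ys \<Longrightarrow> xs = map Some ys"
proof (induction xs arbitrary: ys)
  case (Cons x xs)
  then obtain y zs where "x = Some y" "those xs = Some zs" "ys = y # zs"
    by (cases x; cases "those xs") auto
  with Cons.IH show ?case by simp
qed simp

lemma eval_within_Comp_eq_Some:
  "eval_within (Comp f gs) s xs = Some v \<longleftrightarrow>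
     (\<exists>ys. map (\<lambda>g. eval_within g s xs) gs = map Some ys \<and> eval_within f s ys = Some v)"
proof -
  have eval_within: "eval_within (Comp f gs) s xs = (case those (map (\<lambda>g. eval_within g s xs) gs) of
     None \<Rightarrow> None | Some ys \<Rightarrow> eval_within f s ys)"
    by (simp add: comp_def)
  show ?thesis
  proof
    assume "eval_within (Comp f gs) s xs = Some v"
    then obtain ys where "those (map (\<lambda>g. eval_within g s xs) gs) = Some ys"
        "eval_within f s ys = Some v"
      unfolding eval_within by (cases "those (map (\<lambda>g. eval_within g s xs) gs)") auto
    then show "\<exists>ys. map (\<lambda>g. eval_within g s xs) gs = map Some ys \<and> eval_within f s ys = Some v"
      using those_SomeD by blast
  next
    assume "\<exists>ys. map (\<lambda>g. eval_within g s xs) gs = map Some ys \<and> eval_within f s ys = Some v"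
    then show "eval_within (Comp f gs) s xs = Some v"
      unfolding eval_within by (metis those_map_Some option.case(2))
  qed
qed

text \<open>In the definition, \<open>the_or 0\<close> lets an undefined value stop the search just
  as a zero does; the test behind it then accepts only a genuine zero. This yields the usual reading
  of bounded minimization.\<close>

lemma eval_within_Mu_eq_Some:
  "eval_within (Mu f) s xs = Some k \<longleftrightarrow>
     k < s \<and> eval_within f s (k # xs) = Some 0 \<and> (\<forall>m<k. \<exists>v. eval_within f s (m # xs) = Some (Suc v))"
  (is "?l \<longleftrightarrow> ?r")
proof
  define Q where "Q m \<longleftrightarrow> the_or 0 (eval_within f s (m # xs)) = 0" for m
  have eval_within: "eval_within (Mu f) s xs = (if first_below Q s < s \<and> eval_within f s (first_below Q s # xs) = Some 0
     then Some (first_below Q s) else None)" by (simp add: Q_def [abs_def])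
  have nQ: "\<not> Q m \<longleftrightarrow> (\<exists>v. eval_within f s (m # xs) = Some (Suc v))" for m
    unfolding Q_def the_or_def by (cases "eval_within f s (m # xs)") (auto simp: gr0_conv_Suc)
  show ?r if ?l
    using that first_below_less(2)[of Q s] unfolding eval_within nQ by (auto split: if_splits)
  show ?l if ?r
  proof -
    have "first_below Q s = k"
      using that by (intro first_below_eqI) (auto simp: nQ, simp add: Q_def the_or_def)
    with that show ?thesis unfolding eval_within by simp
  qed
qed

lemma map_eq_map_Some_iff:
  "map f xs = map Some ys \<longleftrightarrow> list_all2 (\<lambda>x y. f x = Some y) xs ys"
  by (auto simp: list_all2_conv_all_nth list_eq_iff_nth_eq)

lemma eval_within_mono: "eval_within r s xs = Some v \<Longrightarrow> s \<le> s' \<Longrightarrow> eval_within r s' xs = Some v"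
proof (induction r arbitrary: xs v)
  case (Comp f gs)
  then obtain ys where ys: "list_all2 (\<lambda>g y. eval_within g s xs = Some y) gs ys"
      "eval_within f s ys = Some v"
    unfolding eval_within_Comp_eq_Some map_eq_map_Some_iff by blast
  have "list_all2 (\<lambda>g y. eval_within g s' xs = Some y) gs ys"
    using ys(1) Comp.IH(2) Comp.prems(2) by (auto simp: list_all2_conv_all_nth)
  with Comp.IH(1)[OF ys(2) Comp.prems(2)] show ?case
    unfolding eval_within_Comp_eq_Some map_eq_map_Some_iff by blast
next
  case (PrimRec f g)
  let ?R = "\<lambda>s xs. rec_nat (eval_within f s (tl xs))
         (\<lambda>k r. case r of None \<Rightarrow> None | Some v \<Rightarrow> eval_within g s (k # v # tl xs))"
  have "?R s xs n = Some v \<Longrightarrow> ?R s' xs n = Some v" for n xs v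
  proof (induction n arbitrary: v)
    case (Suc n)
    then obtain w where w: "?R s xs n = Some w" "eval_within g s (n # w # tl xs) = Some v"
      by (auto split: option.splits)
    show ?case using Suc.IH[OF w(1)] PrimRec.IH(2)[OF w(2) PrimRec.prems(2)] by simp
  qed (use PrimRec in auto)
  with PrimRec.prems show ?case by (auto split: option.splits)
next
  case (Mu f)
  then show ?case unfolding eval_within_Mu_eq_Some by (meson less_le_trans)
qed auto

lemma eval_within_sound: "eval_within r s xs = Some v \<Longrightarrow> recf_eval r xs = Some v"
proof (induction r arbitrary: xs v)
  case (Comp f gs)
  then obtain ys where ys: "list_all2 (\<lambda>g y. eval_within g s xs = Some y) gs ys"
      "eval_within f s ys = Some v"
    unfolding eval_within_Comp_eq_Some map_eq_map_Some_iff by blast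
  have "list_all2 (\<lambda>g y. recf_eval g xs = Some y) gs ys"
    using ys(1) Comp.IH(2) by (auto simp: list_all2_conv_all_nth)
  with Comp.IH(1)[OF ys(2)] show ?case by (metis recf_eval_Comp)
next
  case (PrimRec f g)
  then obtain n ns where xs: "xs = n # ns" by (cases xs) (auto simp: lookup_def)
  have "rec_nat (eval_within f s ns) (\<lambda>k r. case r of None \<Rightarrow> None | Some v \<Rightarrow> eval_within g s (k # v # ns)) n = Some v
     \<Longrightarrow> recf_eval (PrimRec f g) (n # ns) = Some v"
  proof (induction n arbitrary: v)
    case (Suc n)
    then obtain w where w: "rec_nat (eval_within f s ns) (\<lambda>k r. case r of None \<Rightarrow> None
        | Some v \<Rightarrow> eval_within g s (k # v # ns)) n = Some w" "eval_within g s (n # w # ns) = Some v"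
      by (auto split: option.splits)
    show ?case using Suc.IH[OF w(1)] PrimRec.IH(2)[OF w(2)] by simp
  qed (use PrimRec in auto)
  with PrimRec.prems show ?case by (simp add: xs lookup_def)
next
  case (Mu f)
  then have k: "recf_eval f (v # xs) = Some 0" "\<forall>m<v. \<exists>w. recf_eval f (m # xs) = Some (Suc w)"
    unfolding eval_within_Mu_eq_Some by blast+
  have "(THE n. recf_eval f (n # xs) = Some 0 \<and> (\<forall>m<n. \<exists>v. recf_eval f (m # xs) = Some (Suc v))) = v"
  proof (rule the_equality)
    fix n assume n: "recf_eval f (n # xs) = Some 0 \<and> (\<forall>m<n. \<exists>v. recf_eval f (m # xs) = Some (Suc v))"
    then show "n = v" using k
      by (metis linorder_neqE_nat nat.simps(3) option.inject)
  qed (use k in blast)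
  with k show ?case by (auto simp: Let_def)
qed (auto simp: lookup_def hd_conv_nth split: option.splits if_splits list.splits)

lemma ex_uniform_bound:
  fixes P :: "nat \<Rightarrow> 'i \<Rightarrow> bool"
  assumes "finite I" and "\<And>i. i \<in> I \<Longrightarrow> \<exists>s. P s i"
    and mono: "\<And>i s s'. P s i \<Longrightarrow> s \<le> s' \<Longrightarrow> P s' i"
  shows "\<exists>s. \<forall>i\<in>I. P s i"
  using assms(1,2)
proof (induction I)
  case (insert i I)
  then obtain s t where "\<forall>i\<in>I. P s i" "P t i" by blast
  then have "\<forall>j\<in>insert i I. P (max s t) j"
    using mono by (metis insertE max.cobounded1 max.cobounded2)
  then show ?case by blast
qed simp

text \<open>A halting run has finitely many halting subruns; each gets its own bound by induction,
  and by monotonicity the maximum serves them all.\<close>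

lemma eval_within_complete: "recf_eval r xs = Some v \<Longrightarrow> \<exists>s. eval_within r s xs = Some v"
proof (induction r arbitrary: xs v)
  case (Comp f gs)
  define ys where "ys = map (\<lambda>g. the (recf_eval g xs)) gs"
  have *: "recf_eval g xs \<noteq> None" if "g \<in> set gs" for g
    using Comp.prems that by (force simp: Let_def split: if_splits)
  have ex: "\<exists>s. eval_within g s xs = Some (the (recf_eval g xs))" if "g \<in> set gs" for g
    by (rule Comp.IH(2)[OF that]) (use *[OF that] in simp)
  have "\<exists>s. \<forall>g\<in>set gs. eval_within g s xs = Some (the (recf_eval g xs))"
    by (rule ex_uniform_bound) (use ex in \<open>auto intro: eval_within_mono\<close>)
  then obtain s where s: "\<forall>g\<in>set gs. eval_within g s xs = Some (the (recf_eval g xs))" ..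
  have "recf_eval (Comp f gs) xs = recf_eval f ys"
    by (rule recf_eval_Comp) (use * in \<open>auto simp: ys_def list_all2_conv_all_nth\<close>)
  then have "recf_eval f ys = Some v" using Comp.prems by (simp del: recf_eval.simps)
  then obtain t where t: "eval_within f t ys = Some v" using Comp.IH(1) by blast
  have "eval_within g (max s t) xs = Some (the (recf_eval g xs))" if "g \<in> set gs" for g
    by (rule eval_within_mono[where s = s]) (use s that in auto)
  then have "map (\<lambda>g. eval_within g (max s t) xs) gs = map Some ys"
    by (simp add: ys_def)
  moreover have "eval_within f (max s t) ys = Some v" by (rule eval_within_mono[OF t]) simp
  ultimately show ?case unfolding eval_within_Comp_eq_Some by blast
next
  case (PrimRec f g)
  then obtain n ns where xs: "xs = n # ns" by (cases xs) auto
  have "recf_eval (PrimRec f g) (n # ns) = Some v \<Longrightarrow> \<exists>s. eval_within (PrimRec f g) s (n # ns) = Some v"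
  proof (induction n arbitrary: v)
    case 0
    then show ?case using PrimRec.IH(1)[of ns] by (simp add: lookup_def)
  next
    case (Suc n)
    then obtain w where w: "recf_eval (PrimRec f g) (n # ns) = Some w"
        "recf_eval g (n # w # ns) = Some v"
      by (auto simp: bind_eq_Some_conv)
    obtain s t where "eval_within (PrimRec f g) s (n # ns) = Some w"
        "eval_within g t (n # w # ns) = Some v"
      using Suc.IH[OF w(1)] PrimRec.IH(2)[OF w(2)] by blast
    then have "eval_within (PrimRec f g) (max s t) (n # ns) = Some w"
        "eval_within g (max s t) (n # w # ns) = Some v"
      by (auto intro: eval_within_mono simp del: eval_within.simps)
    then show ?case by (intro exI[of _ "max s t"]) (simp add: lookup_def)
  qed
  with PrimRec.prems show ?case by (simp add: xs)
next
  case (Mu f)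
  define P where "P n \<longleftrightarrow> recf_eval f (n # xs) = Some 0 \<and>
                  (\<forall>m<n. \<exists>v. recf_eval f (m # xs) = Some (Suc v))" for n
  have P: "\<exists>n. P n" "v = (THE n. P n)"
    using Mu.prems by (auto simp: Let_def P_def split: if_splits)
  moreover have "n = m" if "P n" "P m" for n m
    using that unfolding P_def by (metis linorder_neqE_nat nat.simps(3) option.inject)
  ultimately have "P v" by (metis theI)
  have def: "\<exists>w. recf_eval f (m # xs) = Some w" if "m \<le> v" for m
    using \<open>P v\<close> that unfolding P_def by (cases "m = v") (blast, metis le_neq_implies_less)
  have "\<exists>s. eval_within f s (m # xs) = Some (the (recf_eval f (m # xs)))" if "m \<in> {..v}" for m
    by (rule Mu.IH) (use def[of m] that in auto)
  then have "\<exists>s. \<forall>m\<in>{..v}. eval_within f s (m # xs) = Some (the (recf_eval f (m # xs)))"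
    by (intro ex_uniform_bound) (auto intro: eval_within_mono)
  then obtain s where s: "\<forall>m\<in>{..v}. eval_within f s (m # xs) = Some (the (recf_eval f (m # xs)))" ..
  \<comment> \<open>\<open>Suc v\<close> because the bounded search returns \<open>v\<close> only
    under a bound larger than \<open>v\<close>.\<close>
  have "eval_within f (max s (Suc v)) (m # xs) = recf_eval f (m # xs)" if "m \<le> v" for m
    using eval_within_mono[of f s "m # xs" "the (recf_eval f (m # xs))" "max s (Suc v)"] s def[OF
        that] that
    by auto
  then have "eval_within (Mu f) (max s (Suc v)) xs = Some v"
    using \<open>P v\<close> unfolding eval_within_Mu_eq_Some P_def by auto
  then show ?case by blast
qed (auto simp: lookup_def split: option.splits if_splits list.splits)

lemma computable_eval_within:
  "computable s \<Longrightarrow> computable xs \<Longrightarrow> computable (\<lambda>x. eval_within r (s x) (xs x))"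
proof -
  have "computable (\<lambda>t. eval_within r (fst t) (snd t))"
  proof (induction r)
    case (Comp f gs)
    \<comment> \<open>The list \<open>gs\<close> is part of the fixed program, so
      \<open>those\<close> unfolds into finitely many nested case distinctions.\<close>
    have "computable (\<lambda>t. those (map (\<lambda>g. eval_within g (fst t) (snd t)) gs))"
      using Comp(2)
    proof (induction gs)
      case (Cons g gs)
      have "computable (\<lambda>t. case eval_within g (fst t) (snd t) of None \<Rightarrow> None
          | Some y \<Rightarrow> (case those (map (\<lambda>g. eval_within g (fst t) (snd t)) gs) of None \<Rightarrow> None
          | Some ys \<Rightarrow> Some (y # ys)))"
        using Cons.prems[of g] computable_app[OF Cons.IH[OF Cons.prems] computable_fst[OF
            computable_id]]
        by (intro computable_intros) auto
      then show ?case by (simp only: list.map those.simps map_option_case)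
    qed (simp add: computable_const)
    then show ?case
      unfolding eval_within.simps map_map comp_def
      by (intro computable_intros computable_app2[OF Comp(1)])
  next
    case (PrimRec f g)
    show ?case
      unfolding eval_within.simps
      by (intro computable_intros computable_app2[OF PrimRec(1)] computable_app2[OF PrimRec(2)])
  next
    case (Mu f)
    show ?case
      unfolding eval_within.simps by (intro computable_intros computable_app2[OF Mu])
  qed (simp; intro computable_intros)+
  then show "computable s \<Longrightarrow> computable xs \<Longrightarrow> computable (\<lambda>x. eval_within r (s x) (xs x))"
    using computable_app[OF _ computable_Pair, of "\<lambda>t. eval_within r (fst t) (snd t)" s xs] by simp
qed

section \<open>Interleaved strings and the measures of their cylinders\<close>

text \<open>With this instance the product sigma-algebra on \<open>cantor\<close> is the Borel one,
  which makes \<open>mu Z\<close> a Borel measure.\<close>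

instance bool :: second_countable_topology
proof
  show "\<exists>B::bool set set. countable B \<and> open = generate_topology B"
    by (intro exI[of _ "range lessThan \<union> range greaterThan"]) (auto simp: open_bool_def)
qed

lemma length_prefix_of [simp]: "length (prefix_of X n) = n"
  and nth_prefix_of [simp]: "i < n \<Longrightarrow> prefix_of X n ! i = X i"
  by (simp_all add: prefix_of_def)

lemma take_prefix_of: "m \<le> n \<Longrightarrow> take m (prefix_of X n) = prefix_of X m"
  by (simp add: prefix_of_def take_map)

lemma prefix_of_eq_iff: "prefix_of X n = \<sigma> \<longleftrightarrow> length \<sigma> = n \<and> (\<forall>i<n. X i = \<sigma> ! i)"
  by (auto simp: list_eq_iff_nth_eq)

lemma mem_cylinder_iff: "X \<in> cylinder \<sigma> \<longleftrightarrow> (\<forall>i<length \<sigma>. X i = \<sigma> ! i)"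
  by (auto simp: cylinder_def prefix_of_eq_iff)

lemma open_cylinder: "open (cylinder \<sigma>)"
proof -
  have "cylinder \<sigma> = (\<Inter>i\<in>{..<length \<sigma>}. (\<lambda>X. X i) -` {\<sigma> ! i})"
    by (intro set_eqI) (simp only: mem_cylinder_iff INT_iff vimage_eq singleton_iff Ball_def
        lessThan_iff)
  also have "open \<dots>"
    by (intro open_INT ballI open_vimage) (auto intro: discrete_topology_class.open_discrete)
  finally show ?thesis .
qed

lemma open_prefix_of: "open {X. Q (prefix_of X n)}"
proof -
  have "{X. Q (prefix_of X n)} = (\<Union>\<sigma>\<in>{\<sigma>. length \<sigma> = n \<and> Q \<sigma>}. cylinder \<sigma>)"
    by (auto simp: cylinder_def)
  also have "open \<dots>" using open_cylinder by blast
  finally show ?thesis .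
qed

text \<open>Giving the even bits as the binary digits of a number \<open>y\<close>, least
  significant first, turns averages over even parts into bounded sums of natural numbers.\<close>

definition weave :: "nat \<Rightarrow> bool list \<Rightarrow> bool list" where
  "weave y \<tau> = map (\<lambda>i. if odd i then lookup \<tau> (i div 2) = Some True else odd (y div 2 ^ (i div 2)))
     [0..<2 * length \<tau>]"

definition odds :: "bool list \<Rightarrow> bool list" where
  "odds \<sigma> = map (\<lambda>i. lookup \<sigma> (2 * i + 1) = Some True) [0..<length \<sigma> div 2]"

text \<open>The preimage of the cylinder of \<open>\<tau>\<close> under the projection to the odd
  positions.\<close>

definition odd_cylinder :: "bool list \<Rightarrow> cantor set" where
  "odd_cylinder \<tau> = {X. \<forall>i<length \<tau>. X (2 * i + 1) = \<tau> ! i}"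

lemma length_weave [simp]: "length (weave y \<tau>) = 2 * length \<tau>"
  by (simp add: weave_def)

lemma nth_weave: "i < 2 * length \<tau> \<Longrightarrow>
    weave y \<tau> ! i = (if odd i then \<tau> ! (i div 2) else odd (y div 2 ^ (i div 2)))"
  by (auto simp: weave_def lookup_def)

lemma odds_eq_prefix_of_iff:
  "odds \<sigma> = prefix_of Z (length \<sigma> div 2) \<longleftrightarrow> (\<forall>i. 2 * i + 1 < length \<sigma> \<longrightarrow> \<sigma> ! (2 * i + 1) = Z i)"
proof -
  have "i < length \<sigma> div 2 \<longleftrightarrow> 2 * i + 1 < length \<sigma>" for i by auto
  then show ?thesis by (auto simp: list_eq_iff_nth_eq odds_def lookup_def)
qed

lemma odds_prefix_of:
  assumes "\<forall>i. X (2 * i + 1) = Z i" shows "odds (prefix_of X n) = prefix_of Z (n div 2)"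
  using odds_eq_prefix_of_iff[of "prefix_of X n" Z] assms by simp

lemma ex_nat_with_bits: "\<exists>y::nat<2 ^ m. \<forall>i<m. odd (y div 2 ^ i) \<longleftrightarrow> f i"
proof (induction m arbitrary: f)
  case (Suc m)
  from Suc[of "\<lambda>i. f (Suc i)"] obtain y :: nat
    where y: "y < 2 ^ m" "\<And>i. i < m \<Longrightarrow> odd (y div 2 ^ i) \<longleftrightarrow> f (Suc i)" by blast
  have "odd ((2 * y + of_bool (f 0)) div 2 ^ i) \<longleftrightarrow> f i" if "i < Suc m" for i
    using that y(2) by (cases i) (auto simp: div_mult2_eq)
  moreover have "2 * y + of_bool (f 0) < 2 ^ Suc m" using y(1) by (auto simp: of_bool_def)
  ultimately show ?case by blast
qed auto

lemma nat_bits_unique: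
  "x < 2 ^ m \<Longrightarrow> y < 2 ^ m \<Longrightarrow> (\<And>i. i < m \<Longrightarrow> odd (x div 2 ^ i) \<longleftrightarrow> odd (y div 2 ^ i)) \<Longrightarrow> x = (y :: nat)"
proof (induction m arbitrary: x y)
  case (Suc m)
  have "x div 2 = y div 2"
  proof (rule Suc.IH)
    show "x div 2 < 2 ^ m" "y div 2 < 2 ^ m"
      using Suc.prems(1,2) by (auto intro!: less_mult_imp_div_less simp: mult.commute)
    show "odd (x div 2 div 2 ^ i) \<longleftrightarrow> odd (y div 2 div 2 ^ i)" if "i < m" for i
      using Suc.prems(3)[of "Suc i"] that by (simp add: div_mult2_eq)
  qed
  moreover have "odd x \<longleftrightarrow> odd y" using Suc.prems(3)[of 0] by simp
  ultimately show ?case by (metis div_mult_mod_eq odd_iff_mod_2_eq_one even_iff_mod_2_eq_zero)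
qed auto

lemma mem_cylinder_weave_iff:
  "X \<in> cylinder (weave y \<tau>) \<longleftrightarrow>
     X \<in> odd_cylinder \<tau> \<and> (\<forall>i<length \<tau>. X (2 * i) \<longleftrightarrow> odd (y div 2 ^ i))"
proof -
  have "(\<forall>i<2 * n. P i) \<longleftrightarrow> (\<forall>i<n. P (2 * i + 1)) \<and> (\<forall>i<n. P (2 * i))" (is "_ \<longleftrightarrow> ?r") for P and n ::
      nat
  proof
    assume ?r
    then show "\<forall>i<2 * n. P i"
    proof (intro allI impI)
      fix i assume "?r" "i < 2 * n"
      then show "P i" by (cases "even i") (fastforce elim!: evenE oddE)+
    qed
  qed simp
  then show ?thesis
    unfolding mem_cylinder_iff length_weave by (simp add: nth_weave odd_cylinder_def)
qed

lemma odd_cylinder_eq_Union: "odd_cylinder \<tau> = (\<Union>y<2 ^ length \<tau>. cylinder (weave y \<tau>))"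
proof (intro set_eqI iffI)
  fix X assume "X \<in> odd_cylinder \<tau>"
  then show "X \<in> (\<Union>y<2 ^ length \<tau>. cylinder (weave y \<tau>))"
    using ex_nat_with_bits[of "length \<tau>" "\<lambda>i. X (2 * i)"] by (auto simp: mem_cylinder_weave_iff)
qed (auto simp: mem_cylinder_weave_iff)

lemma disjoint_weave: "disjoint_family_on (\<lambda>y. cylinder (weave y \<tau>)) {..<2 ^ length \<tau>}"
  unfolding disjoint_family_on_def
proof (intro ballI impI)
  fix x y :: nat
  assume xy: "x \<in> {..<2 ^ length \<tau>}" "y \<in> {..<2 ^ length \<tau>}" "x \<noteq> y"
  have "x = y" if "X \<in> cylinder (weave x \<tau>)" "X \<in> cylinder (weave y \<tau>)" for X
    using xy that by (intro nat_bits_unique[of x "length \<tau>" y]) (auto simp: mem_cylinder_weave_iff)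
  with xy show "cylinder (weave x \<tau>) \<inter> cylinder (weave y \<tau>) = {}" by auto
qed

lemma prefix_of_eq_weave: "X \<in> cylinder (weave y \<tau>) \<Longrightarrow> prefix_of X (2 * length \<tau>) = weave y \<tau>"
  by (simp add: cylinder_def)

lemma borel_prob_cylinder [simp]: "borel_prob \<mu> \<Longrightarrow> cylinder \<sigma> \<in> sets \<mu>"
  unfolding borel_prob_def using open_cylinder by auto

lemma open_odd_cylinder: "open (odd_cylinder \<tau>)"
  unfolding odd_cylinder_eq_Union using open_cylinder by blast

lemma borel_prob_odd_cylinder [simp]: "borel_prob \<mu> \<Longrightarrow> odd_cylinder \<tau> \<in> sets \<mu>"
  unfolding borel_prob_def using open_odd_cylinder by auto

lemma borel_prob_prefix_of [simp]: "borel_prob \<mu> \<Longrightarrow> {X. Q (prefix_of X n)} \<in> sets \<mu>"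
  unfolding borel_prob_def using open_prefix_of by auto

lemma borel_prob_space [simp]: "borel_prob \<mu> \<Longrightarrow> space \<mu> = UNIV"
  unfolding borel_prob_def using sets_eq_imp_space_eq[of \<mu> borel] by simp

text \<open>The push-forward of \<open>\<mu>\<close> under the projection to the odd positions,
  evaluated at a cylinder.\<close>

definition nu :: "cantor measure \<Rightarrow> bool list \<Rightarrow> real" where
  "nu \<mu> \<tau> = measure \<mu> (odd_cylinder \<tau>)"

text \<open>This finite sum is what makes the projected measure approximable from an index of
  \<open>\<mu>\<close>.\<close>

lemma nu_eq_sum:
  assumes "borel_prob \<mu>"
  shows "nu \<mu> \<tau> = (\<Sum>y<2 ^ length \<tau>. measure \<mu> (cylinder (weave y \<tau>)))"
proof -
  interpret prob_space \<mu> using assms by (simp add: borel_prob_def)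
  show ?thesis unfolding nu_def odd_cylinder_eq_Union
    by (intro finite_measure_finite_Union disjoint_weave) (use assms in auto)
qed

section \<open>The measure attached to a real\<close>

definition coin :: "cantor \<Rightarrow> nat \<Rightarrow> bool measure" where
  "coin Z i = measure_pmf (if odd i then return_pmf (Z (i div 2)) else pmf_of_set UNIV)"

definition mu :: "cantor \<Rightarrow> cantor measure" where
  "mu Z = PiM UNIV (coin Z)"

lemma product_prob_space_coin: "product_prob_space (coin Z)"
  unfolding product_prob_space_def product_sigma_finite_def product_prob_space_axioms_def coin_def
  by (auto intro: prob_space_imp_sigma_finite prob_space_measure_pmf)

lemma borel_prob_mu: "borel_prob (mu Z)"
proof -
  interpret product_prob_space "coin Z" UNIV by (rule product_prob_space_coin)
  have "sets (mu Z) = sets (PiM UNIV (\<lambda>i :: nat. borel :: bool measure))"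
    unfolding mu_def by (rule sets_PiM_cong) (auto simp: coin_def sets_borel_eq_count_space)
  also have "\<dots> = sets borel" by (rule sets_PiM_equal_borel)
  finally show ?thesis unfolding borel_prob_def mu_def using P.prob_space_axioms by simp
qed

lemma measure_mu_cylinder_prod:
  "measure (mu Z) (cylinder \<sigma>) = (\<Prod>i<length \<sigma>. measure (coin Z i) {\<sigma> ! i})"
proof -
  interpret product_prob_space "coin Z" UNIV by (rule product_prob_space_coin)
  have "cylinder \<sigma> = prod_emb UNIV (coin Z) {..<length \<sigma>} (PiE {..<length \<sigma>} (\<lambda>i. {\<sigma> ! i}))"
    by (intro set_eqI) (simp add: prod_emb_def mem_cylinder_iff PiE_iff space_PiM coin_def Ball_def)
  then show ?thesis
    unfolding mu_def by (simp add: measure_PiM_emb coin_def)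
qed

lemma measure_coin: "measure (coin Z i) {b} = (if odd i then of_bool (Z (i div 2) = b) else 1 / 2)"
  by (auto simp: coin_def measure_pmf_single indicator_def UNIV_bool)

text \<open>\<open>(n + 1) div 2\<close> is the number of even positions below
  \<open>n\<close>.\<close>

lemma prod_half_even: "(\<Prod>i<n. if odd i then 1 else 1 / 2 :: real) = (1 / 2) ^ ((n + 1) div 2)"
  by (induction n) auto

lemma measure_mu_cylinder:
  "measure (mu Z) (cylinder \<sigma>) =
     (if odds \<sigma> = prefix_of Z (length \<sigma> div 2) then (1 / 2) ^ ((length \<sigma> + 1) div 2) else 0)"
proof (cases "\<forall>i. 2 * i + 1 < length \<sigma> \<longrightarrow> \<sigma> ! (2 * i + 1) = Z i")
  case True
  have "(\<Prod>i<length \<sigma>. measure (coin Z i) {\<sigma> ! i}) = (\<Prod>i<length \<sigma>. if odd i then 1 else 1 / 2)"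
    using True by (intro prod.cong) (auto simp: measure_coin elim!: oddE)
  then show ?thesis
    using True by (simp add: odds_eq_prefix_of_iff measure_mu_cylinder_prod prod_half_even)
next
  case False
  then obtain i where "2 * i + 1 < length \<sigma>" "\<sigma> ! (2 * i + 1) \<noteq> Z i" by blast
  then have "\<exists>j\<in>{..<length \<sigma>}. measure (coin Z j) {\<sigma> ! j} = 0"
    by (intro bexI[of _ "2 * i + 1"]) (auto simp: measure_coin)
  then have "(\<Prod>j<length \<sigma>. measure (coin Z j) {\<sigma> ! j}) = 0"
    by (intro prod_zero) auto
  with False show ?thesis
    by (simp only: odds_eq_prefix_of_iff measure_mu_cylinder_prod if_False)
qed

lemma measure_mu_cylinder_le: "measure (mu Z) (cylinder \<sigma>) \<le> (1 / 2) ^ ((length \<sigma> + 1) div 2)"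
  by (simp add: measure_mu_cylinder)

lemma odds_weave: "odds (weave y \<tau>) = \<tau>"
  by (rule nth_equalityI) (simp_all add: odds_def lookup_def nth_weave)

lemma measure_mu_weave: "measure (mu Z) (cylinder (weave y (prefix_of Z m))) = (1 / 2) ^ m"
  by (simp add: measure_mu_cylinder odds_weave)

text \<open>Each of the \<open>2 ^ m\<close> even parts carries mass \<open>(1 / 2) ^ m\<close>, so
  the projection of \<open>mu Z\<close> is the point mass at \<open>Z\<close>.\<close>

lemma nu_mu: "nu (mu Z) (prefix_of Z m) = 1"
  unfolding nu_eq_sum[OF borel_prob_mu] by (simp add: measure_mu_weave power_divide)

text \<open>The even bits are fair, so a cylinder given by \<open>2 * m\<close> bits has measure at
  most \<open>(1 / 2) ^ m\<close>.\<close>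

lemma continuous_measure_mu: "continuous_measure (mu Z)"
  unfolding continuous_measure_def
proof
  fix X
  interpret prob_space "mu Z" using borel_prob_mu by (simp add: borel_prob_def)
  have le: "measure (mu Z) {X} \<le> (1 / 2) ^ m" for m
  proof -
    have "measure (mu Z) {X} \<le> measure (mu Z) (cylinder (prefix_of X (2 * m)))"
      by (rule finite_measure_mono) (auto simp: mem_cylinder_iff borel_prob_mu)
    also have "\<dots> \<le> (1 / 2) ^ m"
      using measure_mu_cylinder_le[of Z "prefix_of X (2 * m)"] by simp
    finally show ?thesis .
  qed
  have "measure (mu Z) {X} \<le> 0"
    by (rule LIMSEQ_le_const[where X = "\<lambda>m. (1 / 2) ^ m"]) (use le in \<open>auto intro:
        LIMSEQ_power_zero\<close>)
  then show "measure (mu Z) {X} = 0" using measure_nonneg[of "mu Z" "{X}"] by linarith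
qed

section \<open>Fibers of the projection to the odd positions\<close>

definition odd_fiber :: "cantor \<Rightarrow> cantor set" where
  "odd_fiber Z = {X. \<forall>i. X (2 * i + 1) = Z i}"

lemma odd_cylinder_prefix_of: "odd_cylinder (prefix_of Z m) = {X. \<forall>i<m. X (2 * i + 1) = Z i}"
  by (auto simp: odd_cylinder_def)

lemma decseq_odd_cylinder: "decseq (\<lambda>m. odd_cylinder (prefix_of Z m))"
  by (auto simp: decseq_def odd_cylinder_prefix_of)

lemma odd_fiber_eq_Inter: "odd_fiber Z = (\<Inter>m. odd_cylinder (prefix_of Z m))"
  by (auto simp: odd_fiber_def odd_cylinder_prefix_of)

lemma borel_prob_odd_fiber [simp]: "borel_prob \<mu> \<Longrightarrow> odd_fiber Z \<in> sets \<mu>"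
  unfolding odd_fiber_eq_Inter by (intro sets.countable_INT) auto

lemma nu_tendsto:
  assumes "borel_prob \<mu>"
  shows "(\<lambda>m. nu \<mu> (prefix_of Z m)) \<longlonglongrightarrow> measure \<mu> (odd_fiber Z)"
proof -
  interpret prob_space \<mu> using assms by (simp add: borel_prob_def)
  show ?thesis unfolding odd_fiber_eq_Inter nu_def
    by (rule finite_Lim_measure_decseq) (use assms decseq_odd_cylinder in auto)
qed

lemma nu_ge:
  assumes "borel_prob \<mu>" shows "measure \<mu> (odd_fiber Z) \<le> nu \<mu> (prefix_of Z m)"
proof -
  interpret prob_space \<mu> using assms by (simp add: borel_prob_def)
  show ?thesis unfolding nu_def
    by (rule finite_measure_mono) (use assms in \<open>auto simp: odd_fiber_eq_Inter\<close>)
qed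

lemma measure_mu_odd_fiber: "measure (mu Z) (odd_fiber Z) = 1"
  using nu_tendsto[OF borel_prob_mu, of Z Z] by (simp add: nu_mu LIMSEQ_const_iff)

text \<open>Almost surely the odd bits are those of \<open>Z\<close>, so an event decided by
  \<open>2 * m\<close> bits has a probability obtained by counting even parts. A learner that sees
  only a prefix of \<open>Z\<close> can thus compute such probabilities exactly.\<close>

lemma measure_mu_prefix_of:
  "measure (mu Z) {X. Q (prefix_of X (2 * m))} =
     real (\<Sum>y<2 ^ m. of_bool (Q (weave y (prefix_of Z m)))) / 2 ^ m"
proof -
  interpret prob_space "mu Z" using borel_prob_mu by (simp add: borel_prob_def)
  let ?A = "{X. Q (prefix_of X (2 * m))}" and ?\<tau> = "prefix_of Z m"
  define I where "I = {y \<in> {..<2 ^ m}. Q (weave y ?\<tau>)}"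
  have disj: "disjoint_family_on (\<lambda>y. cylinder (weave y ?\<tau>)) I"
    using disjoint_weave[of ?\<tau>] unfolding I_def disjoint_family_on_def by auto
  have "?A \<inter> odd_cylinder ?\<tau> = (\<Union>y\<in>I. cylinder (weave y ?\<tau>))"
    using prefix_of_eq_weave[of _ _ ?\<tau>] unfolding odd_cylinder_eq_Union I_def by fastforce
  moreover have "AE X in mu Z. X \<in> odd_cylinder ?\<tau>"
    using nu_mu[of Z m] unfolding nu_def by (rule AE_prob_1)
  then have "prob (?A \<inter> odd_cylinder ?\<tau>) = prob ?A"
    by (intro finite_measure_eq_AE) (auto simp: borel_prob_mu)
  moreover have "prob (\<Union>y\<in>I. cylinder (weave y ?\<tau>)) = (\<Sum>y\<in>I. (1 / 2) ^ m)"
    using finite_measure_finite_Union[OF _ _ disj]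
    by (simp add: I_def borel_prob_mu measure_mu_weave image_subset_iff)
  moreover have "(\<Sum>y<2 ^ m. of_bool (Q (weave y ?\<tau>))) = card I"
    by (simp add: I_def Int_def sum.If_cases of_bool_def)
  ultimately show ?thesis by (simp add: power_divide)
qed

section \<open>Certificates for inequalities between measures\<close>

lemma computable_prod_decode [computable_intros]:
  assumes "computable f" shows "computable (\<lambda>x. prod_decode (f x))"
  by (rule computable_recf_total1[OF recf_total_nth[of 0] assms]) (simp_all add: code_prod_def
      code_nat_def)

lemma computable_code_list:
  fixes f :: "'a :: coded \<Rightarrow> bool list"
  assumes "computable f" shows "computable (\<lambda>x. str_code (f x))"
  using computable_code[OF assms] by (simp add: code_bool_list)

lemma computable_weave [computable_intros]:
  assumes "computable y" "computable \<tau>" shows "computable (\<lambda>x. weave (y x) (\<tau> x))"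
  unfolding weave_def
  by (intro computable_intros computable_app[OF assms(1)] computable_app[OF assms(2)] assms)

lemma computable_odds [computable_intros]:
  assumes "computable f" shows "computable (\<lambda>x. odds (f x))"
  unfolding odds_def by (intro computable_intros computable_app[OF assms] assms)

lemma computable_prefix_of:
  assumes "computable Z" "computable f" shows "computable (\<lambda>x. prefix_of Z (f x))"
  unfolding prefix_of_def by (intro computable_intros computable_app[OF assms(1)] assms(2))

text \<open>Rounding every approximation down to a multiple of \<open>2\<^sup>-\<^sup>p\<close> keeps the sums over the
  cylinders of a given level in the natural numbers.\<close>

definition dyadic_floor :: "nat \<Rightarrow> nat \<Rightarrow> nat" where
  "dyadic_floor p c = 2 ^ p * fst (prod_decode c) div Suc (snd (prod_decode c))"

text \<open>One unit of the error comes from the approximation and one from the rounding.\<close>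

lemma dyadic_floor_bounds:
  assumes "\<bar>rat_of_code c - x\<bar> \<le> (1 / 2) ^ p"
  shows "\<bar>real (dyadic_floor p c) - 2 ^ p * x\<bar> \<le> 2"
proof -
  obtain a b where c: "prod_decode c = (a, b)" by fastforce
  have "2 ^ p * rat_of_code c = real (2 ^ p * a) / real (Suc b)"
    by (simp add: rat_of_code_def c)
  then have "real (2 ^ p * a div Suc b) \<le> 2 ^ p * rat_of_code c"
    "2 ^ p * rat_of_code c \<le> real (2 ^ p * a div Suc b) + 1"
    using floor_correct[of "real (2 ^ p * a) / real (Suc b)"]
      floor_divide_of_nat_eq[of "2 ^ p * a" "Suc b", where 'a = real]
    by linarith+
  moreover have "2 ^ p * \<bar>rat_of_code c - x\<bar> \<le> 1"
    using mult_left_mono[OF assms, of "2 ^ p"] by (simp add: power_divide)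
  then have "\<bar>2 ^ p * rat_of_code c - 2 ^ p * x\<bar> \<le> 1"
    by (simp add: abs_mult flip: right_diff_distrib)
  ultimately show ?thesis by (simp add: dyadic_floor_def c)
qed

definition approx_defined :: "recf \<Rightarrow> nat \<Rightarrow> nat \<Rightarrow> bool list \<Rightarrow> nat \<Rightarrow> bool" where
  "approx_defined r t e \<tau> p \<longleftrightarrow> (\<forall>y<2 ^ length \<tau>. eval_within r t [e, str_code (weave y \<tau>), p] \<noteq> None)"

text \<open>An integer approximation of \<open>2 ^ p * nu \<mu> \<tau>\<close> at step bound
  \<open>t\<close>. Under \<open>approx_defined\<close> every summand is a computed value and not
  the default 0.\<close>

definition approx_sum :: "recf \<Rightarrow> nat \<Rightarrow> nat \<Rightarrow> bool list \<Rightarrow> nat \<Rightarrow> nat" where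
  "approx_sum r t e \<tau> p =
     (\<Sum>y<2 ^ length \<tau>. dyadic_floor p (the_or 0 (eval_within r t [e, str_code (weave y \<tau>), p])))"

lemma computable_dyadic_floor [computable_intros]:
  "computable p \<Longrightarrow> computable c \<Longrightarrow> computable (\<lambda>x. dyadic_floor (p x) (c x))"
  unfolding dyadic_floor_def by (intro computable_intros)

lemma computable_approx_defined [computable_intros]:
  assumes "computable t" "computable e" "computable \<tau>" "computable p"
  shows "computable (\<lambda>x. approx_defined r (t x) (e x) (\<tau> x) (p x))"
  unfolding approx_defined_def
  by (intro computable_intros computable_eval_within computable_code_list computable_app[OF
      assms(1)]
      computable_app[OF assms(2)] computable_app[OF assms(3)] computable_app[OF assms(4)])

lemma computable_approx_sum [computable_intros]:
  assumes "computable t" "computable e" "computable \<tau>" "computable p"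
  shows "computable (\<lambda>x. approx_sum r (t x) (e x) (\<tau> x) (p x))"
  unfolding approx_sum_def
  by (intro computable_intros computable_eval_within computable_code_list computable_app[OF
      assms(1)]
      computable_app[OF assms(2)] computable_app[OF assms(3)] computable_app[OF assms(4)])

text \<open>Each of the \<open>2 ^ length \<tau>\<close> summands is off by at most 2.\<close>

lemma approx_sum_bounds:
  assumes \<mu>: "borel_prob \<mu>"
    and names: "\<And>\<sigma>. names_real (\<lambda>n. recf_eval r [e, str_code \<sigma>, n]) (measure \<mu> (cylinder \<sigma>))"
    and def: "approx_defined r t e \<tau> p"
  shows "\<bar>real (approx_sum r t e \<tau> p) - 2 ^ p * nu \<mu> \<tau>\<bar> \<le> 2 * 2 ^ length \<tau>"
proof -
  let ?c = "\<lambda>y. the_or 0 (eval_within r t [e, str_code (weave y \<tau>), p])"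
  let ?m = "\<lambda>y. measure \<mu> (cylinder (weave y \<tau>))"
  have "\<bar>real (dyadic_floor p (?c y)) - 2 ^ p * ?m y\<bar> \<le> 2" if "y < 2 ^ length \<tau>" for y
  proof (rule dyadic_floor_bounds)
    obtain c where c: "eval_within r t [e, str_code (weave y \<tau>), p] = Some c"
      using def \<open>y < _\<close> unfolding approx_defined_def by blast
    with names[of "weave y \<tau>"] show "\<bar>rat_of_code (?c y) - ?m y\<bar> \<le> (1 / 2) ^ p"
      unfolding names_real_def by (auto simp: the_or_def dest!: eval_within_sound spec[of _ p])
  qed
  then have "(\<Sum>y<2 ^ length \<tau>. \<bar>real (dyadic_floor p (?c y)) - 2 ^ p * ?m y\<bar>) \<le> (\<Sum>y<(2::nat) ^ length \<tau>. 2)"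
    by (intro sum_mono) auto
  moreover have "real (approx_sum r t e \<tau> p) - 2 ^ p * nu \<mu> \<tau>
      = (\<Sum>y<2 ^ length \<tau>. real (dyadic_floor p (?c y)) - 2 ^ p * ?m y)"
    by (simp add: approx_sum_def nu_eq_sum[OF \<mu>] sum_subtractf sum_distrib_left)
  ultimately show ?thesis
    by (simp only:) (rule order_trans[OF sum_abs], simp)
qed

lemma approx_defined_mono: "approx_defined r t e \<tau> p \<Longrightarrow> t \<le> t' \<Longrightarrow> approx_defined r t' e \<tau> p"
  unfolding approx_defined_def by (metis eval_within_mono not_Some_eq)

lemma ex_approx_defined:
  assumes names: "\<And>\<sigma>. names_real (\<lambda>n. recf_eval r [e, str_code \<sigma>, n]) (measure \<mu> (cylinder \<sigma>))"
  shows "\<exists>t. approx_defined r t e \<tau> p"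
proof -
  have "\<exists>t. eval_within r t [e, str_code (weave y \<tau>), p] \<noteq> None" for y
    using names[of "weave y \<tau>"] unfolding names_real_def by (metis eval_within_complete
        option.discI)
  then have "\<exists>t. \<forall>y\<in>{..<2 ^ length \<tau>}. eval_within r t [e, str_code (weave y \<tau>), p] \<noteq> None"
    by (intro ex_uniform_bound) (auto dest: eval_within_mono)
  then show ?thesis unfolding approx_defined_def by auto
qed

text \<open>A strict inequality holds iff, for some precision \<open>p\<close> and step bound
  \<open>t\<close>, coded together as \<open>w\<close>, it is visible beyond the error bounds. So
  strict inequalities are enumerable and the opposite non-strict ones refutable. \<open>cert\<close>
  is total for every number \<open>e\<close>; that \<open>e\<close> is an index matters only for its
  meaning.\<close>

lemma ex_certificate:
  assumes "uniformly_partial_computable_real M"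
  obtains cert :: "nat \<times> (nat \<times> bool list) \<times> (nat \<times> bool list) \<times> nat \<Rightarrow> bool"
  where "computable cert"
    and "\<And>e \<mu> a \<tau> b \<tau>'. borel_prob \<mu> \<Longrightarrow> measure_index M e \<mu> \<Longrightarrow>
      (\<exists>w. cert (e, (a, \<tau>), (b, \<tau>'), w)) \<longleftrightarrow> real a * nu \<mu> \<tau> < real b * nu \<mu> \<tau>'"
proof -
  obtain r where r: "\<And>e \<sigma> x. M e \<sigma> = Some x \<longleftrightarrow> names_real (\<lambda>n. recf_eval r [e, str_code \<sigma>, n]) x"
    using assms unfolding uniformly_partial_computable_real_def by blast
  define C where "C e a \<tau> b \<tau>' p t \<longleftrightarrow> approx_defined r t e \<tau> p \<and> approx_defined r t e \<tau>' p \<and>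
     a * (approx_sum r t e \<tau> p + 2 * 2 ^ length \<tau>) + b * (2 * 2 ^ length \<tau>')
       < b * approx_sum r t e \<tau>' p" for e a \<tau> b \<tau>' p t
  define cert where "cert = (\<lambda>q. C (fst q) (fst (fst (snd q))) (snd (fst (snd q)))
     (fst (fst (snd (snd q)))) (snd (fst (snd (snd q))))
     (fst (prod_decode (snd (snd (snd q))))) (snd (prod_decode (snd (snd (snd q))))))"
  have "computable cert"
    unfolding cert_def C_def by (intro computable_intros)
  moreover have "(\<exists>w. cert (e, (a, \<tau>), (b, \<tau>'), w)) \<longleftrightarrow> real a * nu \<mu> \<tau> < real b * nu \<mu> \<tau>'"
    if \<mu>: "borel_prob \<mu>" and idx: "measure_index M e \<mu>" for e \<mu> a \<tau> b \<tau>'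
  proof
    have names: "\<And>\<sigma>. names_real (\<lambda>n. recf_eval r [e, str_code \<sigma>, n]) (measure \<mu> (cylinder \<sigma>))"
      using idx r unfolding measure_index_def by blast
    note bounds = approx_sum_bounds[OF \<mu> names]
    {
      assume "\<exists>w. cert (e, (a, \<tau>), (b, \<tau>'), w)"
      then obtain p t where C: "C e a \<tau> b \<tau>' p t" by (auto simp: cert_def)
      define A where "A = approx_sum r t e \<tau> p + 2 * 2 ^ length \<tau>"
      define S where "S = approx_sum r t e \<tau>' p"
      define E where "E = (2 * 2 ^ length \<tau>' :: nat)"
      have "2 ^ p * nu \<mu> \<tau> \<le> real A" "real S \<le> 2 ^ p * nu \<mu> \<tau>' + real E"
        using C bounds[of t \<tau> p] bounds[of t \<tau>' p] unfolding C_def A_def S_def E_def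
        by (auto simp: abs_le_iff)
      then have "real a * (2 ^ p * nu \<mu> \<tau>) \<le> real a * real A"
        "real b * real S \<le> real b * (2 ^ p * nu \<mu> \<tau>' + real E)"
        by (auto intro: mult_left_mono)
      moreover have "a * A + b * E < b * S"
        using C unfolding C_def A_def S_def E_def by blast
      then have "real a * real A + real b * real E < real b * real S"
        by (metis of_nat_less_iff of_nat_add of_nat_mult)
      ultimately have "real a * (2 ^ p * nu \<mu> \<tau>) < real b * (2 ^ p * nu \<mu> \<tau>')"
        unfolding distrib_left by linarith
      then show "real a * nu \<mu> \<tau> < real b * nu \<mu> \<tau>'" by (simp add: mult.left_commute)
    }
    assume less: "real a * nu \<mu> \<tau> < real b * nu \<mu> \<tau>'"
    define d where "d = real b * nu \<mu> \<tau>' - real a * nu \<mu> \<tau>"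
    define E where "E = real a * (2 * 2 ^ length \<tau>) + real b * (2 * 2 ^ length \<tau>')"
    \<comment> \<open>Twice \<open>E\<close>, because the errors enter once through the
      approximations and once through the margins that \<open>C\<close> demands.\<close>
    obtain p :: nat where "2 * E / d < 2 ^ p" using real_arch_pow[of 2 "2 * E / d"] by auto
    then have p: "2 * E < 2 ^ p * d" using less by (simp add: d_def field_simps)
    obtain t1 t2 where "approx_defined r t1 e \<tau> p" "approx_defined r t2 e \<tau>' p"
      using ex_approx_defined[OF names] by blast
    then obtain t where t: "approx_defined r t e \<tau> p" "approx_defined r t e \<tau>' p"
      using approx_defined_mono by (metis max.cobounded1 max.cobounded2)
    have "real (approx_sum r t e \<tau> p + 2 * 2 ^ length \<tau>) \<le> 2 ^ p * nu \<mu> \<tau> + 2 * (2 * 2 ^ length \<tau>)"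
      "2 ^ p * nu \<mu> \<tau>' - 2 * 2 ^ length \<tau>' \<le> real (approx_sum r t e \<tau>' p)"
      using bounds[OF t(1)] bounds[OF t(2)] by (auto simp: abs_le_iff)
    then have "real a * real (approx_sum r t e \<tau> p + 2 * 2 ^ length \<tau>)
          \<le> real a * (2 ^ p * nu \<mu> \<tau> + 2 * (2 * 2 ^ length \<tau>))"
      "real b * (2 ^ p * nu \<mu> \<tau>' - 2 * 2 ^ length \<tau>') \<le> real b * real (approx_sum r t e \<tau>' p)"
      by (auto intro: mult_left_mono)
    then have "real (a * (approx_sum r t e \<tau> p + 2 * 2 ^ length \<tau>) + b * (2 * 2 ^ length \<tau>'))
        < real (b * approx_sum r t e \<tau>' p)"
      using p unfolding d_def E_def by (simp add: algebra_simps)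
    with t have "C e a \<tau> b \<tau>' p t" unfolding C_def of_nat_less_iff by blast
    then show "\<exists>w. cert (e, (a, \<tau>), (b, \<tau>'), w)"
      by (intro exI[of _ "prod_encode (p, t)"]) (simp add: cert_def)
  qed
  ultimately show thesis by (rule that)
qed

section \<open>Random reals\<close>

lemma search_recf2:
  fixes P :: "('a :: coded \<times> 'b :: coded) \<times> nat \<Rightarrow> bool"
  assumes "computable P"
  shows "\<exists>r. \<forall>x y. recf_eval r [code x, code y] =
    (if \<exists>s. P ((x, y), s) then Some (LEAST s. P ((x, y), s)) else None)"
proof -
  obtain r rp where r: "\<And>x. recf_eval r [code x] =
    (if \<exists>s. P (x, s) then Some (LEAST s. P (x, s)) else None)"
    and rp: "\<And>a b. recf_eval rp [a, b] = Some (prod_encode (a, b))"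
    using search_recf[OF assms] prod_encode_recf by metis
  have "recf_eval (Comp r [rp]) [code x, code y] = recf_eval r [code (x, y)]" for x y
    using recf_eval_Comp[of "[code x, code y]" "[rp]" "[code (x, y)]" r] by (simp add: rp
        code_prod_def)
  then show ?thesis using r by metis
qed

text \<open>An enumerable set of strings is the domain of the search for a witness.\<close>

lemma ml_testI:
  fixes P :: "(nat \<times> bool list) \<times> nat \<Rightarrow> bool"
  assumes "computable P" "\<And>n. U n = \<Union> (cylinder ` {\<sigma>. \<exists>s. P ((n, \<sigma>), s)})"
    and "\<And>n. measure \<mu> (U n) \<le> (1 / 2) ^ n"
  shows "ml_test \<mu> U"
proof -
  obtain r where "\<And>n \<sigma>. recf_eval r [code n, code \<sigma>] =
    (if \<exists>s. P ((n, \<sigma>), s) then Some (LEAST s. P ((n, \<sigma>), s)) else None)"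
    using search_recf2[OF assms(1)] by blast
  then have "{\<sigma>. recf_eval r [n, str_code \<sigma>] \<noteq> None} = {\<sigma>. \<exists>s. P ((n, \<sigma>), s)}" for n
    by (simp add: code_nat_def code_bool_list)
  then have "\<forall>n. U n = \<Union> (cylinder ` {\<sigma>. recf_eval r [n, str_code \<sigma>] \<noteq> None})"
    using assms(2) by simp
  with assms(3) show ?thesis unfolding ml_test_def by blast
qed

text \<open>For computable \<open>Z\<close> the complement of the fiber is effectively open: a
  string with a wrong odd bit is recognized. Being null, it forms a constant test.\<close>

lemma ml_random_mu_odd_fiber:
  assumes Z: "computable Z" and X: "ml_random (mu Z) X"
  shows "X \<in> odd_fiber Z"
proof -
  interpret prob_space "mu Z" using borel_prob_mu by (simp add: borel_prob_def)
  have "ml_test (mu Z) (\<lambda>n. - odd_fiber Z)"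
  proof (rule ml_testI)
    show "computable (\<lambda>q. odds (snd (fst q)) \<noteq> prefix_of Z (length (snd (fst q)) div 2))"
      by (intro computable_intros computable_prefix_of[OF Z])
    have "Y \<in> odd_fiber Z \<longleftrightarrow> (\<forall>\<sigma>. Y \<in> cylinder \<sigma> \<longrightarrow> odds \<sigma> = prefix_of Z (length \<sigma> div 2))" for Y
    proof
      show "\<forall>\<sigma>. Y \<in> cylinder \<sigma> \<longrightarrow> odds \<sigma> = prefix_of Z (length \<sigma> div 2)" if "Y \<in> odd_fiber Z"
        using that by (auto simp: odds_eq_prefix_of_iff odd_fiber_def mem_cylinder_iff)
      assume *: "\<forall>\<sigma>. Y \<in> cylinder \<sigma> \<longrightarrow> odds \<sigma> = prefix_of Z (length \<sigma> div 2)"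
      have "Y (2 * i + 1) = Z i" for i
      proof -
        have "Y \<in> cylinder (prefix_of Y (2 * i + 2))" by (simp add: mem_cylinder_iff)
        with * have "\<forall>j. 2 * j + 1 < 2 * i + 2 \<longrightarrow> prefix_of Y (2 * i + 2) ! (2 * j + 1) = Z j"
          using odds_eq_prefix_of_iff[of "prefix_of Y (2 * i + 2)" Z] by auto
        then show ?thesis by (auto dest: spec[of _ i])
      qed
      then show "Y \<in> odd_fiber Z" by (simp add: odd_fiber_def)
    qed
    then show "- odd_fiber Z = \<Union> (cylinder ` {\<sigma>. \<exists>s::nat. odds (snd (fst ((n::nat, \<sigma>), s)))
        \<noteq> prefix_of Z (length (snd (fst ((n, \<sigma>), s))) div 2)})" for n
      by auto
    show "measure (mu Z) (- odd_fiber Z) \<le> (1 / 2) ^ n" for n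
      using prob_compl[of "odd_fiber Z"]
      by (simp add: borel_prob_mu measure_mu_odd_fiber Compl_eq_Diff_UNIV)
  qed
  with X show ?thesis unfolding ml_random_def by auto
qed

instance recf :: countable by countable_datatype

text \<open>There are only countably many programs, hence tests, and each test captures a null set.
  The implication makes the claim vacuous for programs that do not give a test.\<close>

lemma AE_ml_random:
  assumes "borel_prob \<mu>" shows "AE X in \<mu>. ml_random \<mu> X"
proof -
  interpret prob_space \<mu> using assms by (simp add: borel_prob_def)
  define U where "U r n = \<Union> (cylinder ` {\<sigma>. recf_eval r [n, str_code \<sigma>] \<noteq> None})" for r n
  have "open (U r n)" for r n unfolding U_def using open_cylinder by blast
  then have [simp]: "U r n \<in> sets \<mu>" for r n
    using assms unfolding borel_prob_def by simp
  have "AE X in \<mu>. (\<forall>n. prob (U r n) \<le> (1 / 2) ^ n) \<longrightarrow> X \<notin> (\<Inter>n. U r n)" for r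
  proof (cases "\<forall>n. prob (U r n) \<le> (1 / 2) ^ n")
    case True
    have [simp]: "(\<Inter>n. U r n) \<in> sets \<mu>" by (intro sets.countable_INT) auto
    have "prob (\<Inter>n. U r n) \<le> (1 / 2) ^ n" for n
      using finite_measure_mono[of "\<Inter>n. U r n" "U r n"] True by (fastforce intro: order_trans)
    then have "prob (\<Inter>n. U r n) \<le> 0"
      by (intro LIMSEQ_le_const[where X = "\<lambda>m. (1 / 2) ^ m"]) (auto intro: LIMSEQ_power_zero)
    then have "prob (\<Inter>n. U r n) = 0"
      using measure_nonneg[of \<mu> "\<Inter>n. U r n"] by linarith
    then have "(\<Inter>n. U r n) \<in> null_sets \<mu>"
      by (simp add: null_setsI emeasure_eq_measure)
    from AE_not_in[OF this] show ?thesis by (rule eventually_mono) blast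
  qed auto
  then have "AE X in \<mu>. \<forall>r. (\<forall>n. prob (U r n) \<le> (1 / 2) ^ n) \<longrightarrow> X \<notin> (\<Inter>n. U r n)"
    by (simp add: AE_all_countable)
  then show ?thesis
  proof eventually_elim
    case (elim X)
    show ?case unfolding ml_random_def
    proof (intro allI impI)
      fix V assume "ml_test \<mu> V"
      then obtain r where r: "\<And>n. V n = U r n" and le: "\<forall>n. prob (V n) \<le> (1 / 2) ^ n"
        unfolding ml_test_def U_def by metis
      show "X \<notin> (\<Inter>n. V n)" using elim[rule_format, of r] le unfolding r by simp
    qed
  qed
qed

text \<open>If the fiber were null, the cylinders around it would shrink to measure 0. Since
  \<open>Z\<close> is computable and an index of \<open>\<mu>\<close> exists, those of measure below
  \<open>(1 / 2) ^ n\<close> can be enumerated, and they form a test that captures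
  \<open>X\<close>.\<close>

lemma measure_odd_fiber_pos:
  assumes M: "uniformly_partial_computable_real M" and \<mu>: "borel_prob \<mu>" and idx:
      "measure_index M e \<mu>"
    and Z: "computable Z" and X: "ml_random \<mu> X" "X \<in> odd_fiber Z"
  shows "0 < measure \<mu> (odd_fiber Z)"
proof (rule ccontr)
  interpret prob_space \<mu> using \<mu> by (simp add: borel_prob_def)
  assume "\<not> 0 < measure \<mu> (odd_fiber Z)"
  then have "measure \<mu> (odd_fiber Z) = 0"
    using measure_nonneg[of \<mu> "odd_fiber Z"] by linarith
  then have lim: "(\<lambda>m. nu \<mu> (prefix_of Z m)) \<longlonglongrightarrow> 0"
    using nu_tendsto[OF \<mu>, of Z] by simp
  obtain cert :: "nat \<times> (nat \<times> bool list) \<times> (nat \<times> bool list) \<times> nat \<Rightarrow> bool"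
    where cert_comp: "computable cert"
    and "\<And>e \<mu> a \<tau> b \<tau>'. borel_prob \<mu> \<Longrightarrow> measure_index M e \<mu> \<Longrightarrow>
      (\<exists>w. cert (e, (a, \<tau>), (b, \<tau>'), w)) \<longleftrightarrow> real a * nu \<mu> \<tau> < real b * nu \<mu> \<tau>'"
    by (rule ex_certificate[OF M]) (rule that)
  note cert = this(1) this(2)[OF \<mu> idx]
  \<comment> \<open>Certificates compare two values of \<open>nu\<close>; the empty string supplies
    the constant 1.\<close>
  have nu_Nil: "nu \<mu> [] = 1"
    using prob_space \<mu> by (simp add: nu_def odd_cylinder_def)
  define U where "U n = (\<Union>m\<in>{m. 2 ^ n * nu \<mu> (prefix_of Z m) < 1}. odd_cylinder (prefix_of Z m))"
      for n :: nat
  define P where "P = (\<lambda>q :: (nat \<times> bool list) \<times> nat. even (length (snd (fst q))) \<and>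
      odds (snd (fst q)) = prefix_of Z (length (snd (fst q)) div 2) \<and>
      cert (e, (2 ^ fst (fst q), odds (snd (fst q))), (1, []), snd q))"
  have "ml_test \<mu> U"
  proof (rule ml_testI)
    have "computable (\<lambda>q :: (nat \<times> bool list) \<times> nat. \<not> odd (length (snd (fst q))) \<and>
      odds (snd (fst q)) = prefix_of Z (length (snd (fst q)) div 2) \<and>
      cert (e, (2 ^ fst (fst q), odds (snd (fst q))), (1, []), snd q))"
      by (intro computable_conj computable_app[OF cert(1)]
          computable_not computable_odd computable_eq computable_intros computable_prefix_of[OF Z])
    then show "computable P" unfolding P_def by simp
    have "{\<sigma>. \<exists>s. P ((n, \<sigma>), s)} = {\<sigma>. \<exists>m. length \<sigma> = 2 * m \<and> odds \<sigma> = prefix_of Z m \<and>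
       2 ^ n * nu \<mu> (prefix_of Z m) < 1}" for n
      unfolding P_def using cert(2)[of "2 ^ n" _ 1 "[]"]
      by (auto simp: nu_Nil elim!: evenE)
    moreover have "odd_cylinder (prefix_of Z m) = \<Union> (cylinder ` {\<sigma>. length \<sigma> = 2 * m \<and> odds \<sigma> = prefix_of Z m})" for m
    proof -
      have "X \<in> odd_cylinder (prefix_of Z m) \<longleftrightarrow> odds (prefix_of X (2 * m)) = prefix_of Z m" for X
        using odds_eq_prefix_of_iff[of "prefix_of X (2 * m)" Z]
        by (auto simp: odd_cylinder_prefix_of)
      then show ?thesis by (auto simp: cylinder_def)
    qed
    ultimately show "U n = \<Union> (cylinder ` {\<sigma>. \<exists>s. P ((n, \<sigma>), s)})" for n
      unfolding U_def by auto
    show "prob (U n) \<le> (1 / 2) ^ n" for n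
    proof (cases "\<exists>m. 2 ^ n * nu \<mu> (prefix_of Z m) < 1")
      case True
      \<comment> \<open>The cylinders are nested, so the union is its largest member. The least
        \<open>m\<close> is chosen only for this bound; the enumeration does not have to know
        it.\<close>
      define m where "m = (LEAST m. 2 ^ n * nu \<mu> (prefix_of Z m) < 1)"
      have m: "2 ^ n * nu \<mu> (prefix_of Z m) < 1" using True unfolding m_def by (rule LeastI_ex)
      have "U n \<subseteq> odd_cylinder (prefix_of Z m)"
        unfolding U_def using decseq_odd_cylinder[of Z] Least_le[of
            "\<lambda>m. 2 ^ n * nu \<mu> (prefix_of Z m) < 1"]
        unfolding m_def decseq_def by blast
      then have "prob (U n) \<le> nu \<mu> (prefix_of Z m)"
        unfolding nu_def using \<mu> by (intro finite_measure_mono) auto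
      also have "\<dots> \<le> (1 / 2) ^ n" using m by (simp add: power_divide field_simps)
      finally show ?thesis .
    qed (simp add: U_def)
  qed
  moreover have "X \<in> U n" for n
  proof -
    have "eventually (\<lambda>m. nu \<mu> (prefix_of Z m) < (1 / 2) ^ n) sequentially"
      using lim by (rule order_tendstoD) simp
    then obtain m where "nu \<mu> (prefix_of Z m) < (1 / 2) ^ n"
      using eventually_happens by force
    then have "2 ^ n * nu \<mu> (prefix_of Z m) < 1" by (simp add: power_divide field_simps)
    moreover have "X \<in> odd_cylinder (prefix_of Z m)" using X(2) unfolding odd_fiber_eq_Inter by
        blast
    ultimately show ?thesis unfolding U_def by blast
  qed
  ultimately show False using X(1) unfolding ml_random_def by blast
qed

section \<open>Indices of measures and of reals\<close>

text \<open>The pattern of the partial programs below: \<open>P\<close> waits for a stage at which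
  enough information has arrived, and \<open>f\<close> reads the result off that stage.\<close>

lemma search_compute_recf2:
  fixes P :: "('a :: coded \<times> 'b :: coded) \<times> nat \<Rightarrow> bool" and f :: "('a \<times> 'b) \<times> nat \<Rightarrow> 'c :: coded"
  assumes "computable P" "computable f"
  shows "\<exists>r. \<forall>x y. recf_eval r [code x, code y] =
    (if \<exists>s. P ((x, y), s) then Some (code (f ((x, y), LEAST s. P ((x, y), s)))) else None)"
proof -
  obtain rs rp rf where rs: "\<And>x y. recf_eval rs [code x, code y] =
    (if \<exists>s. P ((x, y), s) then Some (LEAST s. P ((x, y), s)) else None)"
    and rp: "\<And>a b. recf_eval rp [a, b] = Some (prod_encode (a, b))"
    and rf: "\<And>t. recf_eval rf [code t] = Some (code (f t))"
    using search_recf2[OF assms(1)] prod_encode_recf assms(2) unfolding computable_def by metis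
  define r where "r = Comp rf [Comp rp [Comp rp [Proj 0, Proj 1], rs]]"
  have "recf_eval r [code x, code y] =
    (if \<exists>s. P ((x, y), s) then Some (code (f ((x, y), LEAST s. P ((x, y), s)))) else None)" for x y
    using rf[of "((x, y), LEAST s. P ((x, y), s))"]
    by (simp add: r_def rs rp code_prod_def code_nat_def)
  then show ?thesis by blast
qed

lemma names_real_unique:
  assumes "names_real h x" "names_real h y" shows "x = y"
proof -
  have "\<bar>x - y\<bar> \<le> 2 * (1 / 2) ^ n" for n
  proof -
    obtain c where "\<bar>rat_of_code c - x\<bar> \<le> (1 / 2) ^ n" "\<bar>rat_of_code c - y\<bar> \<le> (1 / 2) ^ n"
      using assms unfolding names_real_def by (metis option.inject)
    then show ?thesis by linarith
  qed
  moreover have "(\<lambda>n. 2 * (1 / 2) ^ n :: real) \<longlonglongrightarrow> 2 * 0"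
    by (intro tendsto_intros LIMSEQ_power_zero) auto
  ultimately have "\<bar>x - y\<bar> \<le> 0" by (intro LIMSEQ_le_const[where X = "\<lambda>n. 2 * (1 / 2) ^ n"]) auto
  then show ?thesis by simp
qed

text \<open>Partial computability demands an equivalence, so \<open>F\<close> must be undefined
  exactly where the program names no real; uniqueness of the named real makes this
  consistent.\<close>

lemma ex_real_function_of_recf:
  obtains F where "\<And>e \<sigma> x. F e \<sigma> = Some x \<longleftrightarrow> names_real (\<lambda>n. recf_eval r [e, str_code \<sigma>, n]) x"
proof
  fix e \<sigma> x
  let ?N = "names_real (\<lambda>n. recf_eval r [e, str_code \<sigma>, n])"
  show "(if \<exists>x. ?N x then Some (THE x. ?N x) else None) = Some x \<longleftrightarrow> ?N x"
    using names_real_unique by (auto intro: the_equality the1I2 simp: the_equality)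
qed

text \<open>On \<open>e\<close> and \<open>\<sigma>\<close> the program waits until
  \<open>\<phi>\<close> has produced the first \<open>length \<sigma> div 2\<close> bits, compares
  them with the odd bits of \<open>\<sigma>\<close> and outputs the measure of the cylinder.
  Acceptability of \<open>M\<close> then gives an index computably in \<open>e\<close>.\<close>

lemma ex_mu_index:
  assumes \<phi>: "acceptable_numbering \<phi>" and M: "acceptable_measure_enumeration M"
  obtains g where "computable g" "\<And>e Z. real_index \<phi> e Z \<Longrightarrow> measure_index M (g e) (mu Z)"
proof -
  obtain r\<phi> where r\<phi>: "\<And>e n. recf_eval r\<phi> [e, n] = map_option of_bool (\<phi> e n)"
    using \<phi> unfolding acceptable_numbering_def uniformly_partial_computable_def by blast
  define P :: "(nat \<times> bool list) \<times> nat \<Rightarrow> bool" where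
    "P = (\<lambda>t. \<forall>i<length (snd (fst t)) div 2. eval_within r\<phi> (snd t) [fst (fst t), i] \<noteq> None)"
  \<comment> \<open>\<open>rat_of_code\<close> divides by the successor of the second component,
    hence the \<open>- 1\<close> in the code of a power of 1/2.\<close>
  define f :: "(nat \<times> bool list) \<times> nat \<Rightarrow> nat" where
    "f = (\<lambda>t. if \<forall>i<length (snd (fst t)) div 2.
        eval_within r\<phi> (snd t) [fst (fst t), i] = Some (of_bool (lookup (odds (snd (fst t))) i = Some True))
      then prod_encode (1, 2 ^ ((length (snd (fst t)) + 1) div 2) - 1) else prod_encode (0, 0))"
  have pe: "computable (\<lambda>x. prod_encode (u x, v x))" if "computable u" "computable v"
    for u v :: "(nat \<times> bool list) \<times> nat \<Rightarrow> nat"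
    using computable_code[OF computable_Pair[OF that]] by (simp add: code_prod_def code_nat_def)
  have "computable P" unfolding P_def by (intro computable_intros computable_eval_within)
  moreover have "computable f" unfolding f_def by (intro computable_intros computable_eval_within
      pe)
  ultimately obtain r where r: "\<And>e \<sigma>. recf_eval r [code e, code \<sigma>] =
    (if \<exists>s. P ((e, \<sigma>), s) then Some (code (f ((e, \<sigma>), LEAST s. P ((e, \<sigma>), s)))) else None)"
    using search_compute_recf2 by blast
  \<comment> \<open>The value is rational and its code exact, so the same output serves every
    precision, which is the third argument.\<close>
  have r3: "recf_eval (Comp r [Proj 0, Proj 1]) [a, b, c] = recf_eval r [a, b]" for a b c
    by (rule recf_eval_Comp) simp
  obtain F where F: "\<And>e \<sigma> x. F e \<sigma> = Some x \<longleftrightarrow>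
      names_real (\<lambda>n. recf_eval (Comp r [Proj 0, Proj 1]) [e, str_code \<sigma>, n]) x"
    using ex_real_function_of_recf[where r = "Comp r [Proj 0, Proj 1]"] by metis
  have "measure_index F e (mu Z)" if e: "real_index \<phi> e Z" for e Z
    unfolding measure_index_def F
  proof
    fix \<sigma> :: "bool list"
    have val: "eval_within r\<phi> s [e, i] = Some v \<Longrightarrow> v = of_bool (Z i)" for s i v
      using e by (auto dest!: eval_within_sound simp: r\<phi> real_index_def)
    have "\<exists>s. eval_within r\<phi> s [e, i] \<noteq> None" for i
      using eval_within_complete[of r\<phi> "[e, i]"] e by (force simp: r\<phi> real_index_def)
    then have "\<exists>s. \<forall>i\<in>{..<length \<sigma> div 2}. eval_within r\<phi> s [e, i] \<noteq> None"
      by (intro ex_uniform_bound) (auto dest: eval_within_mono)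
    then have ex: "\<exists>s. P ((e, \<sigma>), s)" by (simp add: P_def Ball_def)
    define s where "s = (LEAST s. P ((e, \<sigma>), s))"
    have "P ((e, \<sigma>), s)" unfolding s_def using ex by (rule LeastI_ex)
    then have s: "eval_within r\<phi> s [e, i] = Some (of_bool (Z i))" if "i < length \<sigma> div 2" for i
      using that val by (fastforce simp: P_def)
    have len: "length (odds \<sigma>) = length \<sigma> div 2" by (simp add: odds_def)
    have "odds \<sigma> = prefix_of Z (length \<sigma> div 2) \<longleftrightarrow>
        (\<forall>i<length \<sigma> div 2. (lookup (odds \<sigma>) i = Some True) = Z i)"
      by (simp add: list_eq_iff_nth_eq len lookup_def)
    also have "\<dots> \<longleftrightarrow> (\<forall>i<length \<sigma> div 2. eval_within r\<phi> s [e, i] = Some (of_bool (lookup (odds \<sigma>) i = Some True)))"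
      using s by (auto simp: of_bool_def)
    finally have "rat_of_code (f ((e, \<sigma>), s)) = measure (mu Z) (cylinder \<sigma>)"
      by (simp add: f_def measure_mu_cylinder rat_of_code_def power_divide of_nat_diff)
    then show "names_real (\<lambda>n. recf_eval (Comp r [Proj 0, Proj 1]) [e, str_code \<sigma>, n]) (measure (mu Z) (cylinder \<sigma>))"
      using r[of e \<sigma>] ex unfolding names_real_def r3
      by (simp add: code_nat_def code_bool_list s_def)
  qed
  moreover have "uniformly_partial_computable_real F"
    unfolding uniformly_partial_computable_real_def using F by blast
  then obtain g where "computable_fun g"
      "\<And>e \<mu>. borel_prob \<mu> \<Longrightarrow> measure_index F e \<mu> \<Longrightarrow> measure_index M (g e) \<mu>"
    using M unfolding acceptable_measure_enumeration_def by blast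
  ultimately show thesis
    using that[of g] borel_prob_mu by (auto simp: computable_fun_iff)
qed

lemma computable_measure_if_index:
  assumes M: "uniformly_partial_computable_real M" and "borel_prob \<mu>" "measure_index M e \<mu>"
  shows "computable_measure \<mu>"
proof -
  obtain r where r: "\<And>e \<sigma> x. M e \<sigma> = Some x \<longleftrightarrow> names_real (\<lambda>n. recf_eval r [e, str_code \<sigma>, n]) x"
    using M unfolding uniformly_partial_computable_real_def by blast
  obtain rc where "\<And>xs. length xs = 2 \<Longrightarrow> recf_eval rc xs = Some e"
    using recf_total_const[of 2 e] unfolding recf_total_def by blast
  then have r': "recf_eval (Comp r [rc, Proj 0, Proj 1]) [a, b] = recf_eval r [e, a, b]" for a b
    by (intro recf_eval_Comp) simp
  have "M e \<sigma> = Some (measure \<mu> (cylinder \<sigma>))" for \<sigma>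
    using assms(3) unfolding measure_index_def by blast
  then have "\<forall>\<sigma>. names_real (\<lambda>n. recf_eval (Comp r [rc, Proj 0, Proj 1]) [str_code \<sigma>, n]) (measure \<mu> (cylinder \<sigma>))"
    unfolding r' r by blast
  with assms(2) show ?thesis unfolding computable_measure_def by blast
qed

text \<open>The ratio 2/3 allows a non-strict inequality, which a certificate can refute, but which still
  implies the strict majority needed to single out the prefixes of \<open>Z\<close>.\<close>

definition near :: "cantor measure \<Rightarrow> cantor \<Rightarrow> nat \<Rightarrow> bool" where
  "near \<mu> Z m \<longleftrightarrow> 0 < measure \<mu> (odd_fiber Z) \<and>
     (\<forall>n. 2 * nu \<mu> (prefix_of Z m) \<le> 3 * nu \<mu> (prefix_of Z (m + n)))"

text \<open>The values \<open>nu \<mu> (prefix_of Z m)\<close> decrease to the measure of the fiber.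
  Once below 3/2 of this positive limit, such a value is below 3/2 of all later ones too.\<close>

lemma eventually_near:
  assumes \<mu>: "borel_prob \<mu>" and pos: "0 < measure \<mu> (odd_fiber Z)"
  shows "\<forall>\<^sub>F m in sequentially. near \<mu> Z m"
proof -
  have "\<forall>\<^sub>F m in sequentially. nu \<mu> (prefix_of Z m) < 3 / 2 * measure \<mu> (odd_fiber Z)"
    using nu_tendsto[OF \<mu>] by (rule order_tendstoD) (use pos in simp)
  then show ?thesis
  proof eventually_elim
    case (elim m)
    have "2 * nu \<mu> (prefix_of Z m) \<le> 3 * nu \<mu> (prefix_of Z (m + n))" for n
      using elim nu_ge[OF \<mu>, of Z "m + n"] by linarith
    with pos show ?case by (simp add: near_def)
  qed
qed

text \<open>What makes \<open>e\<close> a reliable voter: from \<open>e\<close> and the prefix of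
  length \<open>m\<close>, every bit of \<open>Z\<close> can be decoded.\<close>

definition follows :: "(nat \<Rightarrow> bool list \<Rightarrow> real option) \<Rightarrow> cantor \<Rightarrow> nat \<Rightarrow> nat \<Rightarrow> bool" where
  "follows M Z m e \<longleftrightarrow> (\<exists>\<mu>. borel_prob \<mu> \<and> measure_index M e \<mu> \<and> near \<mu> Z m)"

text \<open>Distinct strings of length \<open>n\<close> have disjoint cylinders, so two of them
  cannot both take more than half of the same cylinder. The prefix of \<open>Z\<close> does take
  more than half: its share is at least 2/3 and its measure is positive.\<close>

lemma near_majority:
  assumes \<mu>: "borel_prob \<mu>" and near: "near \<mu> Z m" and \<tau>: "length \<tau> = n"
      "take m \<tau> = prefix_of Z m" "m \<le> n"
  shows "nu \<mu> (prefix_of Z m) < 2 * nu \<mu> \<tau> \<longleftrightarrow> \<tau> = prefix_of Z n"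
proof
  interpret prob_space \<mu> using \<mu> by (simp add: borel_prob_def)
  have pos: "nu \<mu> (prefix_of Z m) < 2 * nu \<mu> (prefix_of Z n)"
  proof -
    have "2 * nu \<mu> (prefix_of Z m) \<le> 3 * nu \<mu> (prefix_of Z n)" "0 < measure \<mu> (odd_fiber Z)"
      using near \<tau>(3) le_add_diff_inverse[of m n] unfolding near_def by metis+
    then show ?thesis using nu_ge[OF \<mu>, of Z n] by linarith
  qed
  then show "nu \<mu> (prefix_of Z m) < 2 * nu \<mu> \<tau>" if "\<tau> = prefix_of Z n" using that by simp
  assume less: "nu \<mu> (prefix_of Z m) < 2 * nu \<mu> \<tau>"
  show "\<tau> = prefix_of Z n"
  proof (rule ccontr)
    assume "\<tau> \<noteq> prefix_of Z n"
    then obtain i where "i < n" "\<tau> ! i \<noteq> Z i" using \<tau>(1) by (auto simp: list_eq_iff_nth_eq)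
    then have "odd_cylinder \<tau> \<inter> odd_cylinder (prefix_of Z n) = {}"
      using \<tau>(1) unfolding odd_cylinder_def by auto
    then have "nu \<mu> \<tau> + nu \<mu> (prefix_of Z n) = prob (odd_cylinder \<tau> \<union> odd_cylinder (prefix_of Z n))"
      unfolding nu_def using \<mu> by (intro finite_measure_Union[symmetric]) auto
    also have "\<dots> \<le> nu \<mu> (prefix_of Z m)"
      unfolding nu_def
    proof (rule finite_measure_mono)
      have "\<tau> ! i = Z i" if "i < m" for i
        using \<tau> that by (metis nth_prefix_of nth_take)
      then show "odd_cylinder \<tau> \<union> odd_cylinder (prefix_of Z n) \<subseteq> odd_cylinder (prefix_of Z m)"
        using \<tau> unfolding odd_cylinder_def by auto
    qed (use \<mu> in auto)
    finally show False using pos less by linarith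
  qed
qed

text \<open>The pigeonhole principle, meant for two strict majorities of the same list.\<close>

lemma filters_intersect:
  "length xs < length (filter P xs) + length (filter Q xs) \<Longrightarrow> \<exists>x\<in>set xs. P x \<and> Q x"
  by (induction xs) (auto split: if_splits)

lemma length_filter_mono:
    "(\<And>x. x \<in> set xs \<Longrightarrow> P x \<Longrightarrow> Q x) \<Longrightarrow> length (filter P xs) \<le> length (filter Q xs)"
  by (induction xs) (auto simp: le_Suc_eq)

text \<open>An s-m-n theorem for coded data: the code of \<open>x\<close> takes the place of the
  index in the definition of acceptability.\<close>

lemma ex_numbering_index:
  assumes \<phi>: "acceptable_numbering \<phi>"
  obtains f where "computable f"
    "\<And>(x :: 'a :: coded) Z. (\<And>i. recf_eval r [code x, i] = Some (of_bool (Z i))) \<Longrightarrow> real_index \<phi> (f x) Z"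
proof -
  \<comment> \<open>Outputs of \<open>r\<close> are read as zero or nonzero, so that
    \<open>\<psi>\<close> is 0-1-valued on every input and not only where \<open>r\<close> computes
    a real; \<open>rs\<close> does the same to programs.\<close>
  have "recf_total 1 (\<lambda>xs. if xs ! 0 = 0 then 0 else 1)"
    by (intro recf_total_if_zero recf_total_nth recf_total_const) simp
  then obtain rs where "\<And>xs. length xs = 1 \<Longrightarrow> recf_eval rs xs = Some (if xs ! 0 = 0 then 0 else 1)"
    unfolding recf_total_def by blast
  then have rs: "recf_eval rs [v] = Some (if v = 0 then 0 else 1)" for v by simp
  define \<psi> where "\<psi> e n = map_option (\<lambda>v. v \<noteq> 0) (recf_eval r [e, n])" for e n
  have "recf_eval (Comp rs [r]) [e, n] = map_option of_bool (\<psi> e n)" for e n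
    by (cases "recf_eval r [e, n]") (simp_all add: \<psi>_def rs)
  then have "uniformly_partial_computable \<psi>"
    unfolding uniformly_partial_computable_def by blast
  then obtain f where f: "computable_fun f" "\<And>e. \<phi> (f e) = \<psi> e"
    using \<phi> unfolding acceptable_numbering_def by blast
  show thesis
  proof (rule that)
    show "computable (\<lambda>x :: 'a. f (code x))"
      using f(1) unfolding computable_fun_iff by (rule computable_app) (intro computable_code
          computable_id)
    show "real_index \<phi> (f (code x)) Z" if "\<And>i. recf_eval r [code x, i] = Some (of_bool (Z i))" for
        x :: 'a and Z
      unfolding real_index_def f(2) by (simp add: \<psi>_def that)
  qed
qed

text \<open>To find bit \<open>i\<close>, every index in \<open>es\<close> searches for an extension
  holding more than half of the measure, and a value is output once more than half of the indices
  have voted for it. Those that follow \<open>Z\<close> vote for \<open>Z i\<close> and for nothing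
  else; the others may stay silent or vote for both values.\<close>

lemma ex_majority_index:
  assumes \<phi>: "acceptable_numbering \<phi>" and M: "uniformly_partial_computable_real M"
  obtains G :: "nat list \<times> bool list \<Rightarrow> nat" where "computable G"
    "\<And>es Z m. length es < 2 * length (filter (follows M Z m) es) \<Longrightarrow>
       real_index \<phi> (G (es, prefix_of Z m)) Z"
proof -
  obtain cert :: "nat \<times> (nat \<times> bool list) \<times> (nat \<times> bool list) \<times> nat \<Rightarrow> bool"
    where cert_computable: "computable cert" and cert:
        "\<And>e \<mu> a \<tau> b \<tau>'. borel_prob \<mu> \<Longrightarrow> measure_index M e \<mu> \<Longrightarrow>
      (\<exists>w. cert (e, (a, \<tau>), (b, \<tau>'), w)) \<longleftrightarrow> real a * nu \<mu> \<tau> < real b * nu \<mu> \<tau>'"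
    by (rule ex_certificate[OF M]) (rule that)
  \<comment> \<open>With \<open>Suc i\<close> further bits the extension is longer than
    \<open>i\<close>, whatever the length of \<open>\<tau>\<close>.\<close>
  define ext where "ext \<tau> y k = \<tau> @ map (\<lambda>j. odd (y div 2 ^ j)) [0..<k]" for \<tau> and y k :: nat
  \<comment> \<open>The vote of \<open>e\<close> for \<open>b\<close>; \<open>s\<close> codes a
    guessed extension together with a certificate for its majority.\<close>
  define D where "D e \<tau> i b s \<longleftrightarrow>
      cert (e, (1, \<tau>), (2, ext \<tau> (fst (prod_decode s)) (Suc i)), snd (prod_decode s)) \<and>
      (lookup (ext \<tau> (fst (prod_decode s)) (Suc i)) i = Some True) = b" for e \<tau> i b s
  define maj where "maj es \<tau> i s b \<longleftrightarrow> length es < 2 * length (filter (\<lambda>e. \<exists>s'<s. D e \<tau> i b s') es)"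
    for es \<tau> i s b
  have D_sound: "b = Z i" if f: "follows M Z m e" and D: "D e (prefix_of Z m) i b s" for Z m e i b s
  proof -
    define \<tau> where "\<tau> = ext (prefix_of Z m) (fst (prod_decode s)) (Suc i)"
    obtain \<mu> where \<mu>: "borel_prob \<mu>" "measure_index M e \<mu>" "near \<mu> Z m"
      using f unfolding follows_def by blast
    have "real 1 * nu \<mu> (prefix_of Z m) < real 2 * nu \<mu> \<tau>"
      using D unfolding cert[OF \<mu>(1,2), symmetric] D_def \<tau>_def by blast
    moreover have "length \<tau> = m + Suc i" "take m \<tau> = prefix_of Z m" by (simp_all add: \<tau>_def ext_def)
    ultimately have "\<tau> = prefix_of Z (m + Suc i)"
      using near_majority[OF \<mu>(1,3), of \<tau> "m + Suc i"] by simp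
    then show ?thesis using D unfolding D_def \<tau>_def[symmetric] by (auto simp: lookup_def)
  qed
  have D_complete: "\<exists>s. D e (prefix_of Z m) i (Z i) s" if f: "follows M Z m e" for Z m e i
  proof -
    obtain \<mu> where \<mu>: "borel_prob \<mu>" "measure_index M e \<mu>" "near \<mu> Z m"
      using f unfolding follows_def by blast
    obtain y :: nat where y: "\<And>j. j < Suc i \<Longrightarrow> odd (y div 2 ^ j) \<longleftrightarrow> Z (m + j)"
      using ex_nat_with_bits[of "Suc i" "\<lambda>j. Z (m + j)"] by blast
    have ext: "ext (prefix_of Z m) y (Suc i) = prefix_of Z (m + Suc i)"
      using y by (intro nth_equalityI) (auto simp: ext_def nth_append simp del: upt_Suc)
    have "nu \<mu> (prefix_of Z m) < 2 * nu \<mu> (prefix_of Z (m + Suc i))"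
      using near_majority[OF \<mu>(1,3), of "prefix_of Z (m + Suc i)" "m + Suc i"] by (simp add:
          take_prefix_of)
    then obtain w where "cert (e, (1, prefix_of Z m), (2, prefix_of Z (m + Suc i)), w)"
      using cert[OF \<mu>(1,2), of 1 "prefix_of Z m" 2 "prefix_of Z (m + Suc i)"] by auto
    then have "D e (prefix_of Z m) i (Z i) (prod_encode (y, w))"
      unfolding D_def by (simp add: ext lookup_def)
    then show ?thesis by blast
  qed
  have D_computable: "computable (\<lambda>x. D (e x) (\<tau> x) (i x) (b x) (s x))"
    if "computable e" "computable \<tau>" "computable i" "computable b" "computable s"
    for e :: "'z :: coded \<Rightarrow> nat" and \<tau> i b s
    unfolding D_def ext_def
    by (intro computable_conj computable_app[OF cert_computable] computable_intros that
        computable_app[OF that(1)]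
        computable_app[OF that(2)] computable_app[OF that(3)] computable_app[OF that(4)]
            computable_app[OF that(5)])
  define P where "P = (\<lambda>t :: ((nat list \<times> bool list) \<times> nat) \<times> nat.
     maj (fst (fst (fst t))) (snd (fst (fst t))) (snd (fst t)) (snd t) True \<or>
     maj (fst (fst (fst t))) (snd (fst (fst t))) (snd (fst t)) (snd t) False)"
  define f where "f = (\<lambda>t :: ((nat list \<times> bool list) \<times> nat) \<times> nat.
     maj (fst (fst (fst t))) (snd (fst (fst t))) (snd (fst t)) (snd t) True)"
  have "computable P" unfolding P_def maj_def
    by (intro computable_intros D_computable)
  moreover have "computable f" unfolding f_def maj_def
    by (intro computable_intros D_computable)
  ultimately obtain r where r: "\<And>x i. recf_eval r [code x, code i] =
    (if \<exists>s. P ((x, i), s) then Some (code (f ((x, i), LEAST s. P ((x, i), s)))) else None)"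
    using search_compute_recf2 by blast
  obtain G :: "nat list \<times> bool list \<Rightarrow> nat" where G: "computable G"
    "\<And>x Z. (\<And>i. recf_eval r [code x, i] = Some (of_bool (Z i))) \<Longrightarrow> real_index \<phi> (G x) Z"
    using ex_numbering_index[OF \<phi>] by metis
  show thesis
  proof (rule that[OF G(1) G(2)])
    fix es Z m i
    assume half: "length es < 2 * length (filter (follows M Z m) es)"
    let ?\<tau> = "prefix_of Z m"
    have maj_sound: "b = Z i" if "maj es ?\<tau> i s b" for s b
    proof -
      \<comment> \<open>The majority voting for \<open>b\<close> and the majority that follows
        \<open>Z\<close> share an index.\<close>
      have "\<exists>e\<in>set es. follows M Z m e \<and> (\<exists>s'<s. D e ?\<tau> i b s')"
        by (rule filters_intersect) (use half that in \<open>auto simp: maj_def\<close>)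
      then show ?thesis using D_sound by blast
    qed
    have "\<exists>s. \<exists>s'<s. D e ?\<tau> i (Z i) s'" if "follows M Z m e" for e
      using D_complete[OF that] lessI by blast
    then have "\<exists>s. \<forall>e\<in>{e \<in> set es. follows M Z m e}. \<exists>s'<s. D e ?\<tau> i (Z i) s'"
      by (intro ex_uniform_bound) (auto intro: less_le_trans)
    then obtain s where s: "\<And>e. e \<in> set es \<Longrightarrow> follows M Z m e \<Longrightarrow> \<exists>s'<s. D e ?\<tau> i (Z i) s'" by blast
    have "maj es ?\<tau> i s (Z i)"
      using half length_filter_mono[of es "follows M Z m" "\<lambda>e. \<exists>s'<s. D e ?\<tau> i (Z i) s'", OF s]
      unfolding maj_def by linarith
    then have ex: "\<exists>s. P (((es, ?\<tau>), i), s)" unfolding P_def by (cases "Z i") auto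
    have "P (((es, ?\<tau>), i), LEAST s. P (((es, ?\<tau>), i), s))" using ex by (rule LeastI_ex)
    \<comment> \<open>Some value has a majority at this stage and the wrong one never gets it, so
      asking about \<open>True\<close> settles the bit.\<close>
    then have "f (((es, ?\<tau>), i), LEAST s. P (((es, ?\<tau>), i), s)) = Z i"
      unfolding P_def f_def by (auto dest: maj_sound)
    then show "recf_eval r [code (es, ?\<tau>), i] = Some (of_bool (Z i))"
      using r[of "(es, ?\<tau>)" i] ex by (simp add: code_nat_def code_bool_def)
  qed
qed

section \<open>From learners of reals to learners of measures\<close>

lemma eventually_div2:
  assumes "\<forall>\<^sub>F n in sequentially. P n" shows "\<forall>\<^sub>F n in sequentially. P (n div 2 :: nat)"
proof -
  obtain N where "\<And>n. n \<ge> N \<Longrightarrow> P n" using assms unfolding eventually_sequentially by blast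
  then have "P (n div 2)" if "n \<ge> 2 * N" for n using that by simp
  then show ?thesis unfolding eventually_sequentially by blast
qed

text \<open>The learner names \<open>mu Z\<close> itself; \<open>n\<close> bits of a random
  \<open>X\<close> show it \<open>n div 2\<close> bits of \<open>Z\<close>.\<close>

lemma EX_imp_weakly_EX:
  assumes \<phi>: "acceptable_numbering \<phi>" and M: "acceptable_measure_enumeration M"
    and C: "\<forall>Z\<in>C. computable_real Z" and EX: "EX_learnable \<phi> C"
  shows "(\<forall>\<nu>\<in>mu ` C. computable_measure \<nu>) \<and> weakly_EX_learnable M (mu ` C)"
proof -
  obtain g where g: "computable g" "\<And>e Z. real_index \<phi> e Z \<Longrightarrow> measure_index M (g e) (mu Z)"
    using ex_mu_index[OF \<phi> M] by metis
  obtain L where L: "computable_learner L"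
    "\<And>Z. Z \<in> C \<Longrightarrow> \<exists>e. (\<lambda>n. L (prefix_of Z n)) \<longlonglongrightarrow> e \<and> real_index \<phi> e Z"
    using EX unfolding EX_learnable_def by blast
  have comp: "computable_measure (mu Z)" if "Z \<in> C" for Z
    using computable_measure_if_index[OF _ borel_prob_mu] L(2)[OF that] g(2) M
    unfolding acceptable_measure_enumeration_def by blast
  have "computable_learner (\<lambda>\<sigma>. g (L (odds \<sigma>)))"
    using computable_app[OF g(1) computable_app[OF L(1)[unfolded computable_learner_iff]
        computable_odds[OF computable_id]]]
    by (simp add: computable_learner_iff)
  moreover have "\<exists>e \<mu>'. (\<lambda>n. g (L (odds (prefix_of X n)))) \<longlonglongrightarrow> e \<and>
            computable_measure \<mu>' \<and> measure_index M e \<mu>' \<and> ml_random \<mu>' X"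
    if "Z \<in> C" "ml_random (mu Z) X" for Z X
  proof -
    have "X \<in> odd_fiber Z"
      using ml_random_mu_odd_fiber that C by (simp add: computable_real_iff)
    then have odds: "odds (prefix_of X n) = prefix_of Z (n div 2)" for n
      by (intro odds_prefix_of) (simp add: odd_fiber_def)
    obtain e where e: "(\<lambda>n. L (prefix_of Z n)) \<longlonglongrightarrow> e" "real_index \<phi> e Z" using L(2) \<open>Z \<in> C\<close> by blast
    then have "\<forall>\<^sub>F n in sequentially. L (prefix_of Z n) = e" by (simp add: tendsto_discrete)
    from eventually_div2[OF this] have "\<forall>\<^sub>F n in sequentially. g (L (odds (prefix_of X n))) = g e"
      unfolding odds by (rule eventually_mono) simp
    then have "(\<lambda>n. g (L (odds (prefix_of X n)))) \<longlonglongrightarrow> g e" by (simp add: tendsto_discrete)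
    then show ?thesis using comp g(2)[OF e(2)] that by blast
  qed
  ultimately show ?thesis using comp unfolding weakly_EX_learnable_def by blast
qed

lemma BC_imp_weakly_BC:
  assumes \<phi>: "acceptable_numbering \<phi>" and M: "acceptable_measure_enumeration M"
    and C: "\<forall>Z\<in>C. computable_real Z" and BC: "BC_learnable \<phi> C"
  shows "(\<forall>\<nu>\<in>mu ` C. computable_measure \<nu>) \<and> weakly_BC_learnable M (mu ` C)"
proof -
  obtain g where g: "computable g" "\<And>e Z. real_index \<phi> e Z \<Longrightarrow> measure_index M (g e) (mu Z)"
    using ex_mu_index[OF \<phi> M] by metis
  obtain L where L: "computable_learner L"
    "\<And>Z. Z \<in> C \<Longrightarrow> \<forall>\<^sub>F n in sequentially. real_index \<phi> (L (prefix_of Z n)) Z"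
    using BC unfolding BC_learnable_def by blast
  have comp: "computable_measure (mu Z)" if "Z \<in> C" for Z
    using computable_measure_if_index[OF _ borel_prob_mu] eventually_happens'[OF _ L(2)[OF that]]
        g(2) M
    unfolding acceptable_measure_enumeration_def by (metis sequentially_bot)
  have "computable_learner (\<lambda>\<sigma>. g (L (odds \<sigma>)))"
    using computable_app[OF g(1) computable_app[OF L(1)[unfolded computable_learner_iff]
        computable_odds[OF computable_id]]]
    by (simp add: computable_learner_iff)
  moreover have "\<exists>n0 \<mu>'. computable_measure \<mu>' \<and> ml_random \<mu>' X \<and>
            (\<forall>n>n0. measure_index M (g (L (odds (prefix_of X n)))) \<mu>')"
    if "Z \<in> C" "ml_random (mu Z) X" for Z X
  proof -
    have "X \<in> odd_fiber Z"
      using ml_random_mu_odd_fiber that C by (simp add: computable_real_iff)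
    then have odds: "odds (prefix_of X n) = prefix_of Z (n div 2)" for n
      by (intro odds_prefix_of) (simp add: odd_fiber_def)
    have "\<forall>\<^sub>F n in sequentially. measure_index M (g (L (odds (prefix_of X n)))) (mu Z)"
      using eventually_div2[OF L(2)[OF \<open>Z \<in> C\<close>]] unfolding odds by (rule eventually_mono) (rule
          g(2))
    then show ?thesis using comp that unfolding eventually_sequentially by (meson less_imp_le)
  qed
  ultimately show ?thesis using comp unfolding weakly_BC_learnable_def by blast
qed

section \<open>From learners of measures to learners of reals\<close>

lemma length_filter_map_upt:
  "length (filter P (map f [0..<n])) = (\<Sum>y<n. of_bool (P (f y)))"
  by (induction n) auto

lemma weakly_BC_imp_BC:
  assumes \<phi>: "acceptable_numbering \<phi>" and M: "acceptable_measure_enumeration M"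
    and C: "\<forall>Z\<in>C. computable_real Z" and BC: "weakly_BC_learnable M (mu ` C)"
  shows "BC_learnable \<phi> C"
proof -
  have M': "uniformly_partial_computable_real M"
    using M unfolding acceptable_measure_enumeration_def by blast
  obtain G :: "nat list \<times> bool list \<Rightarrow> nat" where G: "computable G"
    "\<And>es Z m. length es < 2 * length (filter (follows M Z m) es) \<Longrightarrow>
       real_index \<phi> (G (es, prefix_of Z m)) Z"
    using ex_majority_index[OF \<phi> M'] by metis
  obtain L where L: "computable L" and BC: "\<And>Z X. Z \<in> C \<Longrightarrow> ml_random (mu Z) X \<Longrightarrow>
         \<exists>n0 \<mu>'. computable_measure \<mu>' \<and> ml_random \<mu>' X \<and>
            (\<forall>n>n0. measure_index M (L (prefix_of X n)) \<mu>')"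
    using BC unfolding weakly_BC_learnable_def computable_learner_iff by blast
  define K where "K \<zeta> = G (map (\<lambda>y. L (weave y \<zeta>)) [0..<2 ^ length \<zeta>], \<zeta>)" for \<zeta>
  have "computable K"
    unfolding K_def by (intro computable_app[OF G(1)] computable_intros computable_app[OF L])
  moreover have "\<forall>\<^sub>F n in sequentially. real_index \<phi> (K (prefix_of Z n)) Z" if Z: "Z \<in> C" for Z
  proof -
    interpret prob_space "mu Z" using borel_prob_mu by (simp add: borel_prob_def)
    define B where "B m = {X. follows M Z m (L (prefix_of X (2 * m)))}" for m
    \<comment> \<open>The sets \<open>B m\<close> need not be monotone. The sets \<open>D n\<close>
      increase to a set of full measure, so some \<open>D n\<close>, and with it \<open>B n\<close>,
      has measure above 1/2 from some \<open>n\<close> on.\<close>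
    define D where "D n = (\<Inter>m\<in>{n..}. B m)" for n
    have [simp]: "B m \<in> sets (mu Z)" for m
      unfolding B_def using borel_prob_prefix_of[OF borel_prob_mu] .
    have [simp]: "D n \<in> sets (mu Z)" for n
      unfolding D_def by (intro sets.countable_INT') auto
    have "X \<in> (\<Union>n. D n)" if "ml_random (mu Z) X" for X
    proof -
      obtain n0 \<mu> where \<mu>: "computable_measure \<mu>" "ml_random \<mu> X"
        "\<And>n. n > n0 \<Longrightarrow> measure_index M (L (prefix_of X n)) \<mu>"
        using BC[OF Z \<open>ml_random (mu Z) X\<close>] by blast
      have bp: "borel_prob \<mu>" using \<mu>(1) by (simp add: computable_measure_def)
      have Zc: "computable Z" using C Z by (simp add: computable_real_iff)
      have "0 < measure \<mu> (odd_fiber Z)"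
        using measure_odd_fiber_pos[OF M' bp \<mu>(3)[of "Suc n0"] Zc \<mu>(2)]
          ml_random_mu_odd_fiber[OF Zc \<open>ml_random (mu Z) X\<close>] by simp
      then obtain n1 where "\<And>m. m \<ge> n1 \<Longrightarrow> near \<mu> Z m"
        using eventually_near[OF bp] unfolding eventually_sequentially by blast
      then have "X \<in> B m" if "m \<ge> max n1 (Suc n0)" for m
        using \<mu>(3)[of "2 * m"] bp that unfolding B_def follows_def by auto
      then have "X \<in> D (max n1 (Suc n0))" unfolding D_def by simp
      then show ?thesis by blast
    qed
    then have "AE X in mu Z. X \<in> (\<Union>n. D n)"
      using AE_ml_random[OF borel_prob_mu, of Z] by (auto elim: eventually_mono)
    then have "prob (\<Union>n. D n) = 1" by (subst prob_eq_1) auto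
    moreover have "incseq D" unfolding incseq_def D_def by (auto intro: order_trans)
    then have "(\<lambda>n. prob (D n)) \<longlonglongrightarrow> prob (\<Union>n. D n)"
      by (intro finite_Lim_measure_incseq) auto
    ultimately have "\<forall>\<^sub>F n in sequentially. 1 / 2 < prob (D n)"
      by (intro order_tendstoD) auto
    then show ?thesis
    proof eventually_elim
      case (elim m)
      have "prob (D m) \<le> prob (B m)" by (intro finite_measure_mono) (auto simp: D_def)
      with elim have "1 / 2 < prob (B m)" by linarith
      also have "prob (B m) = real (\<Sum>y<2 ^ m. of_bool (follows M Z m (L (weave y (prefix_of Z m))))) / 2 ^ m"
        unfolding B_def by (rule measure_mu_prefix_of)
      finally have "real (2 ^ m) < real (2 * (\<Sum>y<2 ^ m. of_bool (follows M Z m (L (weave y (prefix_of Z m))))))"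
        by (simp add: field_simps)
      then have "2 ^ m < 2 * (\<Sum>y<2 ^ m. of_bool (follows M Z m (L (weave y (prefix_of Z m)))) :: nat)"
        unfolding of_nat_less_iff .
      then show ?case unfolding K_def by (intro G(2)) (simp only: length_filter_map_upt length_map
          length_upt
          length_prefix_of diff_zero)
    qed
  qed
  ultimately show ?thesis unfolding BC_learnable_def computable_learner_iff by blast
qed

text \<open>Identification in the limit: below the least true hypothesis there are only finitely
  many, and each of them is eventually rejected.\<close>

lemma eventually_first_below:
  assumes acc: "\<And>h. T h \<Longrightarrow> \<forall>\<^sub>F n in sequentially. ok n h"
    and rej: "\<And>h. \<not> T h \<Longrightarrow> \<forall>\<^sub>F n in sequentially. \<not> ok n h"
    and ex: "T h0"
  shows "\<exists>h. T h \<and> (\<forall>\<^sub>F n in sequentially. first_below (ok n) n = h)"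
proof -
  define h where "h = (LEAST h. T h)"
  have h: "T h" "\<And>k. k < h \<Longrightarrow> \<not> T k"
    unfolding h_def using ex by (auto intro: LeastI dest: not_less_Least)
  have "\<forall>\<^sub>F n in sequentially. \<forall>k\<in>{..<h}. \<not> ok n k"
    using rej h(2) by (intro eventually_ball_finite) auto
  moreover have "\<forall>\<^sub>F n in sequentially. ok n h" using acc h(1) .
  moreover have "\<forall>\<^sub>F n in sequentially. h < n" by (rule eventually_gt_at_top)
  ultimately have "\<forall>\<^sub>F n in sequentially. first_below (ok n) n = h"
    by eventually_elim (rule first_below_eqI, auto)
  with h(1) show ?thesis by blast
qed

lemma weakly_EX_imp_EX:
  assumes \<phi>: "acceptable_numbering \<phi>" and M: "acceptable_measure_enumeration M"
    and C: "\<forall>Z\<in>C. computable_real Z" and EX: "weakly_EX_learnable M (mu ` C)"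
  shows "EX_learnable \<phi> C"
proof -
  have M': "uniformly_partial_computable_real M"
    using M unfolding acceptable_measure_enumeration_def by blast
  obtain G :: "nat list \<times> bool list \<Rightarrow> nat" where G: "computable G"
    "\<And>es Z m. length es < 2 * length (filter (follows M Z m) es) \<Longrightarrow>
       real_index \<phi> (G (es, prefix_of Z m)) Z"
    using ex_majority_index[OF \<phi> M'] by metis
  obtain cert :: "nat \<times> (nat \<times> bool list) \<times> (nat \<times> bool list) \<times> nat \<Rightarrow> bool"
    where cert_computable: "computable cert" and cert:
        "\<And>e \<mu> a \<tau> b \<tau>'. borel_prob \<mu> \<Longrightarrow> measure_index M e \<mu> \<Longrightarrow>
      (\<exists>w. cert (e, (a, \<tau>), (b, \<tau>'), w)) \<longleftrightarrow> real a * nu \<mu> \<tau> < real b * nu \<mu> \<tau>'"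
    by (rule ex_certificate[OF M']) (rule that)
  obtain L where L: "computable L" and EX: "\<And>Z X. Z \<in> C \<Longrightarrow> ml_random (mu Z) X \<Longrightarrow>
         \<exists>e \<mu>'. (\<lambda>n. L (prefix_of X n)) \<longlonglongrightarrow> e \<and>
            computable_measure \<mu>' \<and> measure_index M e \<mu>' \<and> ml_random \<mu>' X"
    using EX unfolding weakly_EX_learnable_def computable_learner_iff by blast
  define stable where "stable e k \<sigma> \<longleftrightarrow> (\<forall>j\<le>length \<sigma>. k \<le> j \<longrightarrow> L (take j \<sigma>) = e)" for e k \<sigma>
  \<comment> \<open>For a prefix \<open>\<tau>\<close> of \<open>Z\<close>: as far as
    \<open>2 * length \<tau>\<close> bits can show, \<open>L\<close> stays at \<open>e\<close> from
    \<open>k\<close> on with probability at least \<open>(1 / 2) ^ k\<close>. Denominators are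
    cleared.\<close>
  define many where "many e k \<tau> \<longleftrightarrow>
      2 ^ length \<tau> \<le> 2 ^ k * (\<Sum>y<2 ^ length \<tau>. of_bool (stable e k (weave y \<tau>)) :: nat)" for e k \<tau>
  \<comment> \<open>The number \<open>k\<close> is at once the stage of convergence, the exponent of
    the probability bound and the length of the prefix. Each of these may be enlarged once it is
    large enough, so one number serves for all. The factors 3 and 2 are those of
    \<open>near\<close>.\<close>
  define hyp where "hyp Z e k \<longleftrightarrow> (\<forall>n. many e k (prefix_of Z n)) \<and>
      (\<forall>n\<ge>k. \<forall>w. \<not> cert (e, (3, prefix_of Z n), (2, prefix_of Z k), w))" for Z e k
  \<comment> \<open>What \<open>\<zeta>\<close> can test of \<open>hyp\<close>. As
    \<open>\<zeta>\<close> grows, these conditions can only become false, except for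
    \<open>k \<le> length \<zeta>\<close>, which ensures that \<open>take k \<zeta>\<close> has
    length \<open>k\<close>.\<close>
  define ok where "ok \<zeta> e k \<longleftrightarrow> k \<le> length \<zeta> \<and> (\<forall>n\<le>length \<zeta>. many e k (take n \<zeta>)) \<and>
      (\<forall>n\<le>length \<zeta>. k \<le> n \<longrightarrow> (\<forall>w<length \<zeta>. \<not> cert (e, (3, take n \<zeta>), (2, take k \<zeta>), w)))" for \<zeta> e k
  \<comment> \<open>If no hypothesis is left, the result is \<open>length \<zeta>\<close>; this is
    harmless, as only the limit counts.\<close>
  define guess where "guess \<zeta> = first_below (\<lambda>h. ok \<zeta> (fst (prod_decode h)) (snd (prod_decode h))) (length \<zeta>)" for \<zeta>
  define K where "K \<zeta> = G ([fst (prod_decode (guess \<zeta>))], take (snd (prod_decode (guess \<zeta>))) \<zeta>)"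
      for \<zeta>
  have stable_computable: "computable (\<lambda>x. stable (e x) (k x) (\<sigma> x))"
    if "computable e" "computable k" "computable \<sigma>" for e k and \<sigma> :: "'z :: coded \<Rightarrow> bool list"
    unfolding stable_def
    by (intro computable_intros computable_app[OF L] that computable_app[OF that(1)]
        computable_app[OF that(2)] computable_app[OF that(3)])
  have many_computable: "computable (\<lambda>x. many (e x) (k x) (\<tau> x))"
    if "computable e" "computable k" "computable \<tau>" for e k and \<tau> :: "'z :: coded \<Rightarrow> bool list"
    unfolding many_def
    by (intro computable_intros stable_computable that computable_app[OF that(1)]
        computable_app[OF that(2)] computable_app[OF that(3)])
  have guess_computable: "computable guess"
    unfolding guess_def ok_def
    by (intro computable_intros many_computable computable_app[OF cert_computable])
  have "computable K"
    unfolding K_def by (intro computable_app[OF G(1)] computable_intros computable_app[OF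
        guess_computable])
  moreover have "\<exists>e. (\<lambda>n. K (prefix_of Z n)) \<longlonglongrightarrow> e \<and> real_index \<phi> e Z" if Z: "Z \<in> C" for Z
  proof -
    interpret prob_space "mu Z" using borel_prob_mu by (simp add: borel_prob_def)
    have Zc: "computable Z" using C Z by (simp add: computable_real_iff)
    define A where "A e k = {X. \<forall>j\<ge>k. L (prefix_of X j) = e}" for e k
    \<comment> \<open>Clopen sets decreasing to \<open>A e k\<close>, whose measures can be computed
      from prefixes of \<open>Z\<close>.\<close>
    define A' where "A' e k n = {X. stable e k (prefix_of X (2 * n))}" for e k n
    have [simp]: "A' e k n \<in> sets (mu Z)" for e k n
      unfolding A'_def using borel_prob_prefix_of[OF borel_prob_mu] .
    have A'_iff: "X \<in> A' e k n \<longleftrightarrow> (\<forall>j\<le>2 * n. k \<le> j \<longrightarrow> L (prefix_of X j) = e)" for X e k n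
      unfolding A'_def stable_def by (simp add: take_prefix_of)
    have A_eq: "A e k = (\<Inter>n. A' e k n)" for e k
    proof -
      have "L (prefix_of X j) = e" if "\<And>n. X \<in> A' e k n" "k \<le> j" for X j
        using that(1)[of j] that(2) unfolding A'_iff by simp
      then show ?thesis by (auto simp: A'_iff A_def)
    qed
    have [simp]: "A e k \<in> sets (mu Z)" for e k
      unfolding A_eq by (intro sets.countable_INT) auto
    have many_iff: "many e k (prefix_of Z n) \<longleftrightarrow> (1 / 2) ^ k \<le> prob (A' e k n)" for e k n
    proof -
      let ?s = "\<Sum>y<2 ^ n. of_bool (stable e k (weave y (prefix_of Z n))) :: nat"
      have "many e k (prefix_of Z n) \<longleftrightarrow> real (2 ^ n) \<le> real (2 ^ k * ?s)"
        unfolding many_def of_nat_le_iff by simp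
      also have "\<dots> \<longleftrightarrow> (1 / 2) ^ k \<le> real ?s / 2 ^ n"
        by (simp add: field_simps power_divide)
      also have "real ?s / 2 ^ n = prob (A' e k n)"
        unfolding A'_def by (rule measure_mu_prefix_of[symmetric])
      finally show ?thesis .
    qed
    have all_many_iff: "(\<forall>n. many e k (prefix_of Z n)) \<longleftrightarrow> (1 / 2) ^ k \<le> prob (A e k)" for e k
    proof
      assume *: "\<forall>n. many e k (prefix_of Z n)"
      have "decseq (A' e k)" unfolding decseq_def by (auto simp: A'_iff)
      then have "(\<lambda>n. prob (A' e k n)) \<longlonglongrightarrow> prob (A e k)"
        unfolding A_eq by (intro finite_Lim_measure_decseq) auto
      then show "(1 / 2) ^ k \<le> prob (A e k)"
        by (rule LIMSEQ_le_const) (use * many_iff in auto)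
    next
      assume *: "(1 / 2) ^ k \<le> prob (A e k)"
      have "prob (A e k) \<le> prob (A' e k n)" for n
        by (rule finite_measure_mono) (auto simp: A_eq)
      with * show "\<forall>n. many e k (prefix_of Z n)" unfolding many_iff by (meson order_trans)
    qed
    \<comment> \<open>Without a random real \<open>A e k\<close> would be null; at a random real in
      it, the limit of \<open>L\<close>, which is \<open>e\<close>, has to be an index.\<close>
    have random: "\<exists>\<mu>. borel_prob \<mu> \<and> measure_index M e \<mu> \<and> 0 < measure \<mu> (odd_fiber Z)"
      if pos: "0 < prob (A e k)" for e k
    proof -
      have "\<exists>X\<in>A e k. ml_random (mu Z) X"
      proof (rule ccontr)
        assume "\<not> ?thesis"
        then have "AE X in mu Z. X \<notin> A e k"
          using AE_ml_random[OF borel_prob_mu, of Z] by (auto elim: eventually_mono)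
        then have "prob (A e k) = 0" by (simp add: prob_eq_0)
        with pos show False by simp
      qed
      then obtain X where X: "X \<in> A e k" "ml_random (mu Z) X" by blast
      obtain e' \<mu> where \<mu>: "(\<lambda>n. L (prefix_of X n)) \<longlonglongrightarrow> e'" "computable_measure \<mu>"
        "measure_index M e' \<mu>" "ml_random \<mu> X"
        using EX[OF Z X(2)] by blast
      have "\<forall>\<^sub>F n in sequentially. L (prefix_of X n) = e"
        using X(1) unfolding A_def eventually_sequentially by blast
      then have "(\<lambda>n. L (prefix_of X n)) \<longlonglongrightarrow> e" by (simp add: tendsto_discrete)
      then have "e' = e" using \<mu>(1) LIMSEQ_unique by blast
      moreover have bp: "borel_prob \<mu>" using \<mu>(2) by (simp add: computable_measure_def)
      ultimately show ?thesis
        using measure_odd_fiber_pos[OF M' bp \<mu>(3) Zc \<mu>(4) ml_random_mu_odd_fiber[OF Zc X(2)]] \<mu>(3)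
            by blast
    qed
    have hyp_follows: "follows M Z k e" if "hyp Z e k" for e k
    proof -
      have "(1 / 2) ^ k \<le> prob (A e k)" using that all_many_iff unfolding hyp_def by blast
      then have "0 < prob (A e k)" by (rule less_le_trans[rotated]) simp
      then obtain \<mu> where \<mu>: "borel_prob \<mu>" "measure_index M e \<mu>" "0 < measure \<mu> (odd_fiber Z)"
        using random by blast
      have "2 * nu \<mu> (prefix_of Z k) \<le> 3 * nu \<mu> (prefix_of Z (k + n))" for n
        using cert[OF \<mu>(1,2), of 3 "prefix_of Z (k + n)" 2 "prefix_of Z k"] that
        unfolding hyp_def by (simp add: not_less)
      with \<mu> show ?thesis unfolding follows_def near_def by blast
    qed
    have "\<exists>e k. hyp Z e k"
    proof -
      \<comment> \<open>Every random real lies in one of the countably many sets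
        \<open>A e k\<close>, so not all of them are null.\<close>
      have "\<exists>e k. 0 < prob (A e k)"
      proof (rule ccontr)
        assume "\<not> ?thesis"
        then have "prob (A e k) = 0" for e k using measure_nonneg[of "mu Z" "A e k"] by (auto
            simp: not_less order_antisym)
        then have "AE X in mu Z. X \<notin> A e k" for e k by (simp add: prob_eq_0)
        then have "AE X in mu Z. \<forall>e k. X \<notin> A e k" by (simp add: AE_all_countable)
        then have "AE X in mu Z. False"
          using AE_ml_random[OF borel_prob_mu, of Z]
        proof eventually_elim
          case (elim X)
          then obtain e where "(\<lambda>n. L (prefix_of X n)) \<longlonglongrightarrow> e" using EX[OF Z] by blast
          then obtain k where "X \<in> A e k"
            unfolding A_def by (auto simp: tendsto_discrete eventually_sequentially)
          with elim show False by blast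
        qed
        then show False using AE_False by (simp add: emeasure_space_1)
      qed
      then obtain e k0 where pos: "0 < prob (A e k0)" by blast
      then obtain \<mu> where \<mu>: "borel_prob \<mu>" "measure_index M e \<mu>" "0 < measure \<mu> (odd_fiber Z)"
        using random by blast
      \<comment> \<open>Keeping \<open>e\<close> and enlarging \<open>k\<close> beyond
        \<open>k0\<close> leaves the measure at least as large while the required bound falls below
        it.\<close>
      have "\<forall>\<^sub>F k in sequentially. (1 / 2) ^ k < prob (A e k0)"
        by (rule order_tendstoD[OF LIMSEQ_power_zero]) (use pos in auto)
      then have "\<forall>\<^sub>F k in sequentially. hyp Z e k"
        using eventually_near[OF \<mu>(1,3)] eventually_ge_at_top[of k0]
      proof eventually_elim
        case (elim k)
        have "prob (A e k0) \<le> prob (A e k)"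
        proof (rule finite_measure_mono)
          show "A e k0 \<subseteq> A e k" using \<open>k0 \<le> k\<close> by (auto simp: A_def)
        qed simp
        with elim have "\<forall>n. many e k (prefix_of Z n)" unfolding all_many_iff by linarith
        moreover have "\<not> cert (e, (3, prefix_of Z n), (2, prefix_of Z k), w)" if "n \<ge> k" for n w
        proof -
          have "2 * nu \<mu> (prefix_of Z k) \<le> 3 * nu \<mu> (prefix_of Z n)"
            using \<open>near \<mu> Z k\<close> that unfolding near_def by (metis le_add_diff_inverse)
          then show ?thesis
            using cert[OF \<mu>(1,2), of 3 "prefix_of Z n" 2 "prefix_of Z k"] by auto
        qed
        ultimately show ?case unfolding hyp_def by blast
      qed
      then show ?thesis using eventually_happens' sequentially_bot by blast
    qed
    then obtain e0 k0 where h0: "hyp Z e0 k0" by blast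
    have ok_prefix: "ok (prefix_of Z N) e k \<longleftrightarrow> k \<le> N \<and> (\<forall>n\<le>N. many e k (prefix_of Z n)) \<and>
      (\<forall>n\<le>N. k \<le> n \<longrightarrow> (\<forall>w<N. \<not> cert (e, (3, prefix_of Z n), (2, prefix_of Z k), w)))" for N e k
      unfolding ok_def by (auto simp: take_prefix_of)
    have "\<exists>h. hyp Z (fst (prod_decode h)) (snd (prod_decode h)) \<and>
       (\<forall>\<^sub>F n in sequentially. first_below (\<lambda>h. ok (prefix_of Z n) (fst (prod_decode h)) (snd (prod_decode h))) n = h)"
    proof (rule eventually_first_below)
      show "hyp Z (fst (prod_decode (prod_encode (e0, k0)))) (snd (prod_decode (prod_encode (e0, k0))))"
        using h0 by simp
    next
      fix h assume "hyp Z (fst (prod_decode h)) (snd (prod_decode h))"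
      then have "ok (prefix_of Z n) (fst (prod_decode h)) (snd (prod_decode h))" if
          "n \<ge> snd (prod_decode h)" for n
        using that unfolding ok_prefix hyp_def by blast
      then show "\<forall>\<^sub>F n in sequentially. ok (prefix_of Z n) (fst (prod_decode h)) (snd (prod_decode h))"
        unfolding eventually_sequentially by blast
    next
      fix h assume "\<not> hyp Z (fst (prod_decode h)) (snd (prod_decode h))"
      then consider n where "\<not> many (fst (prod_decode h)) (snd (prod_decode h)) (prefix_of Z n)"
        | n w where "n \<ge> snd (prod_decode h)"
          "cert (fst (prod_decode h), (3, prefix_of Z n), (2, prefix_of Z (snd (prod_decode h))), w)"
        unfolding hyp_def by blast
      then show "\<forall>\<^sub>F n in sequentially. \<not> ok (prefix_of Z n) (fst (prod_decode h)) (snd (prod_decode h))"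
      proof cases
        case (1 n)
        then have "\<not> ok (prefix_of Z N) (fst (prod_decode h)) (snd (prod_decode h))" if "N \<ge> n"
            for N
          using that unfolding ok_prefix by blast
        then show ?thesis unfolding eventually_sequentially by blast
      next
        case (2 n w)
        then have "\<not> ok (prefix_of Z N) (fst (prod_decode h)) (snd (prod_decode h))" if
            "N \<ge> max n (Suc w)" for N
          using that unfolding ok_prefix by (auto simp: Suc_le_eq)
        then show ?thesis unfolding eventually_sequentially by blast
      qed
    qed
    then obtain h where hyp: "hyp Z (fst (prod_decode h)) (snd (prod_decode h))"
      and "\<forall>\<^sub>F n in sequentially. guess (prefix_of Z n) = h"
      unfolding guess_def length_prefix_of by blast
    define e k where "e = fst (prod_decode h)" and "k = snd (prod_decode h)"
    have hyp: "hyp Z e k" and ev: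
        "\<forall>\<^sub>F n in sequentially. guess (prefix_of Z n) = prod_encode (e, k)"
      using hyp \<open>\<forall>\<^sub>F n in sequentially. guess (prefix_of Z n) = h\<close> by (simp_all add: e_def k_def)
    have "\<forall>\<^sub>F n in sequentially. K (prefix_of Z n) = G ([e], prefix_of Z k)"
      using ev eventually_ge_at_top[of k] by eventually_elim (simp add: K_def take_prefix_of)
    then have "(\<lambda>n. K (prefix_of Z n)) \<longlonglongrightarrow> G ([e], prefix_of Z k)"
      by (simp add: tendsto_discrete)
    \<comment> \<open>In a list with one element, a single following index is a strict
      majority.\<close>
    moreover have "real_index \<phi> (G ([e], prefix_of Z k)) Z"
      by (rule G(2)) (simp add: hyp_follows[OF hyp])
    ultimately show ?thesis by blast
  qed
  ultimately show ?thesis unfolding EX_learnable_def computable_learner_iff by blast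
qed

theorem theorem1p7:
  fixes \<phi> :: "nat \<Rightarrow> nat \<Rightarrow> bool option"
    and M :: "nat \<Rightarrow> bool list \<Rightarrow> real option"
  assumes "acceptable_numbering \<phi>"
    and "acceptable_measure_enumeration M"
  shows "\<exists>\<mu> :: cantor \<Rightarrow> cantor measure.
    (\<forall>Z. borel_prob (\<mu> Z) \<and> continuous_measure (\<mu> Z)) \<and>
    (\<forall>C. (\<forall>Z\<in>C. computable_real Z) \<longrightarrow>
      (EX_learnable \<phi> C \<longleftrightarrow>
         (\<forall>\<nu>\<in>\<mu> ` C. computable_measure \<nu>) \<and> weakly_EX_learnable M (\<mu> ` C)) \<and>
      (BC_learnable \<phi> C \<longleftrightarrow>
         (\<forall>\<nu>\<in>\<mu> ` C. computable_measure \<nu>) \<and> weakly_BC_learnable M (\<mu> ` C)))"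
proof (intro exI[of _ mu] conjI allI impI)
  fix C :: "cantor set" assume C: "\<forall>Z\<in>C. computable_real Z"
  show "EX_learnable \<phi> C \<longleftrightarrow>
      (\<forall>\<nu>\<in>mu ` C. computable_measure \<nu>) \<and> weakly_EX_learnable M (mu ` C)"
    using EX_imp_weakly_EX[OF assms C] weakly_EX_imp_EX[OF assms C] by blast
  show "BC_learnable \<phi> C \<longleftrightarrow>
      (\<forall>\<nu>\<in>mu ` C. computable_measure \<nu>) \<and> weakly_BC_learnable M (mu ` C)"
    using BC_imp_weakly_BC[OF assms C] weakly_BC_imp_BC[OF assms C] by blast
qed (rule borel_prob_mu continuous_measure_mu)+

end
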